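(* Let $E$ be a separable Banach space and let $(\mathcal{X},\|\cdot\|_{\mathcal{X}})$ be a decomposable normed subspace of $L_0(\Omega,E)$ which is topologically contained (i.e. contained with continuous inclusion) in some Lebesgue space $L_p(\Omega,E,\beta\mu)$, $1\le p\le\infty$, for some measurable positive valued function $\beta$. Suppose that the Fréchet bornology (the family of norm bounded sets) on $\mathcal{X}$ is solid. Let $f:\Omega\times E\to\overline{\mathbb{R}}$ be a measurable integrand, $x_0\in\mathcal{X}$ with $I_f(x_0)$ finite, $x^*\in\mathcal{X}^*\cap L_0(\Omega,E^*_{\sigma^*})$, and consider the assertions: (a) $x^*$ is a Fréchet subderivative of $I_f$ at $x_0$ on $\mathcal{X}$; (b) the integrand $f-\langle x^*,\cdot\rangle$ has the Fréchet-differential lower compactness property at $x_0$ on $\mathcal{X}$. Then (a) $\Rightarrow$ (b). If moreover $x^*$ is a Fréchet subderivative of $f$ along $x_0$, then (b) $\Rightarrow$ (a).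
   Context: $(\Omega,\mathbb{T},\mu)$ is a measure space with $\mu$ a $\sigma$-finite positive measure and $\mathbb{T}$ $\mu$-complete. $L_0(\Omega,E)$ is the space of classes (a.e. equality) of measurable functions $\Omega\to E$; $L_p(\Omega,E,\nu)$ is the Lebesgue–Bochner space for the measure $\nu$. A measurable integrand is a $\mathbb{T}\otimes\mathcal{B}(E)$-measurable function $\Omega\times E\to\overline{\mathbb{R}}$. $I_f(x)=\int^*_\Omega f(\omega,x(\omega))\,d\mu(\omega)$ with $\int^*_\Omega v\,d\mu=\inf\{\int_\Omega u\,d\mu: u\in L_1(\Omega,\mathbb{R}),\ u\ge v\text{ a.e.}\}$. $\mathcal{X}$ is decomposable if $x1_A+y1_{A^c}\in\mathcal{X}$ for all $x,y\in\mathcal{X}$, $A\in\mathbb{T}$. The Fréchet bornology is solid if for every norm bounded $X\subset\mathcal{X}$ the set $\{x1_A: x\in X, A\in\mathbb{T}\}$ is norm bounded in $\mathcal{X}$. $x^*\in\mathcal{X}^*\cap L_0(\Omega,E^*_{\sigma^*})$ means that $x^*:\Omega\to E^*$ is scalarly measurable and $x\mapsto\int_\Omega\langle x^*,x\rangle\,d\mu$ is a well-defined continuous linear functional on $\mathcal{X}$. For a function $J$ on a normed space $Y$, finite at $y_0$, $y^*\in Y^*$ is a Fréchet subderivative of $J$ at $y_0$ if $\liminf_{y\to y_0}\frac{J(y)-J(y_0)-\langle y^*,y-y_0\rangle}{\|y-y_0\|}\ge0$. $x^*\in L_0(\Omega,E^*_{\sigma^*})$ is a Fréchet subderivative of $f$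 along $x_0$ if for almost every $\omega$, $x^*(\omega)$ is a Fréchet subderivative of $f_\omega=f(\omega,\cdot)$ at $x_0(\omega)$. A subset $X$ of $L_1(\Omega,\mathbb{R})$ is uniformly integrable if it is bounded in $L_1$ and for every $\epsilon>0$ there are $\eta>0$ and a measurable $K$ of finite measure with $\sup_{u\in X}\|u1_A\|_1<\epsilon$ whenever $\mu(A)\le\eta$, and $\sup_{u\in X}\|u1_{K^c}\|_1<\epsilon$. An integrand $g$ has the Fréchet-differential lower compactness property at $x_0$ on $\mathcal{X}$ if for every sequence $(r_n)_n$ of positive numbers converging to $0$ and every norm bounded sequence $(x_n)_n$ in $\mathcal{X}$, the negative parts of the functions $\omega\mapsto r_n^{-1}(g(\omega,x_0(\omega)+r_nx_n(\omega))-g(\omega,x_0(\omega)))$ form, for $n\ge n_0$ with some $n_0$, a uniformly integrable family in $L_1(\Omega,\mathbb{R})$. *)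

theory Defs
  imports "HOL-Analysis.Analysis" "HOL-Probability.Essential_Supremum"
begin

text \<open>A separable Banach space is a type of sort \<open>{banach, second_countable_topology}\<close>.
  Extended real arithmetic below only ever subtracts a value that is finite (almost everywhere).\<close>

definition measurable_integrand ::
    "'w measure \<Rightarrow> ('w \<Rightarrow> 'e::topological_space \<Rightarrow> ereal) \<Rightarrow> bool" where
  "measurable_integrand M f \<longleftrightarrow> (\<lambda>(\<omega>, e). f \<omega> e) \<in> borel_measurable (M \<Otimes>\<^sub>M borel)"

text \<open>The infimum over the empty set is \<open>\<infinity>\<close>.\<close>

definition upper_integral :: "'w measure \<Rightarrow> ('w \<Rightarrow> ereal) \<Rightarrow> ereal" where
  "upper_integral M v =
     (INF u\<in>{u :: 'w \<Rightarrow> real. integrable M u \<and> (AE \<omega> in M. v \<omega> \<le> ereal (u \<omega>))}.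
        ereal (integral\<^sup>L M u))"

definition integral_functional ::
    "'w measure \<Rightarrow> ('w \<Rightarrow> 'e \<Rightarrow> ereal) \<Rightarrow> ('w \<Rightarrow> 'e) \<Rightarrow> ereal" where
  "integral_functional M f x = upper_integral M (\<lambda>\<omega>. f \<omega> (x \<omega>))"


text \<open>Lebesgue--Bochner spaces, for separable \<open>E\<close>, as sets of representatives; \<open>p = \<infinity>\<close> is the
  space of essentially bounded functions.\<close>

definition Lp_space ::
    "ennreal \<Rightarrow> 'w measure \<Rightarrow> ('w \<Rightarrow> 'e::{real_normed_vector, second_countable_topology}) set" where
  "Lp_space p M = {x \<in> borel_measurable M.
     if p = \<infinity> then esssup M (\<lambda>\<omega>. ennreal (norm (x \<omega>))) < \<infinity>
     else (\<integral>\<^sup>+ \<omega>. ennreal (norm (x \<omega>) powr enn2real p) \<partial>M) < \<infinity>}"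

definition Lp_norm ::
    "ennreal \<Rightarrow> 'w measure \<Rightarrow> ('w \<Rightarrow> 'e::{real_normed_vector, second_countable_topology}) \<Rightarrow> real" where
  "Lp_norm p M x =
     (if p = \<infinity> then enn2real (esssup M (\<lambda>\<omega>. ennreal (norm (x \<omega>))))
      else enn2real (\<integral>\<^sup>+ \<omega>. ennreal (norm (x \<omega>) powr enn2real p) \<partial>M) powr (1 / enn2real p))"


text \<open>A normed subspace of \<open>L\<^sub>0(\<Omega>, E)\<close> is a normed space \<open>'x\<close> together with a map \<open>\<iota>\<close> choosing a
  measurable representative for each element. The map is linear and injective modulo almost
  everywhere equality, so \<open>'x\<close> is identified with a linear subspace of the space of classes, and
  the norm of \<open>'x\<close> is the norm of that subspace.\<close>

definition normed_L0_subspace ::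
    "'w measure \<Rightarrow> ('x::real_normed_vector \<Rightarrow> 'w \<Rightarrow> 'e::{real_normed_vector, second_countable_topology})
      \<Rightarrow> bool" where
  "normed_L0_subspace M \<iota> \<longleftrightarrow>
     (\<forall>x. \<iota> x \<in> borel_measurable M) \<and>
     (\<forall>x y. AE \<omega> in M. \<iota> (x + y) \<omega> = \<iota> x \<omega> + \<iota> y \<omega>) \<and>
     (\<forall>c x. AE \<omega> in M. \<iota> (c *\<^sub>R x) \<omega> = c *\<^sub>R \<iota> x \<omega>) \<and>
     (\<forall>x y. (AE \<omega> in M. \<iota> x \<omega> = \<iota> y \<omega>) \<longrightarrow> x = y)"

definition decomposable :: "'w measure \<Rightarrow> ('x \<Rightarrow> 'w \<Rightarrow> 'e::real_vector) \<Rightarrow> bool" where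
  "decomposable M \<iota> \<longleftrightarrow>
     (\<forall>x y. \<forall>A\<in>sets M. \<exists>z. AE \<omega> in M.
        \<iota> z \<omega> = indicat_real A \<omega> *\<^sub>R \<iota> x \<omega> + indicat_real (space M - A) \<omega> *\<^sub>R \<iota> y \<omega>)"

text \<open>The Frechet bornology consists of the norm bounded sets.\<close>

definition solid_frechet_bornology ::
    "'w measure \<Rightarrow> ('x::real_normed_vector \<Rightarrow> 'w \<Rightarrow> 'e::real_vector) \<Rightarrow> bool" where
  "solid_frechet_bornology M \<iota> \<longleftrightarrow>
     (\<forall>X. bounded X \<longrightarrow>
        bounded {z. \<exists>x\<in>X. \<exists>A\<in>sets M. AE \<omega> in M. \<iota> z \<omega> = indicat_real A \<omega> *\<^sub>R \<iota> x \<omega>})"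

definition continuously_included_in_Lp ::
    "('x::real_normed_vector \<Rightarrow> 'w \<Rightarrow> 'e::{real_normed_vector, second_countable_topology})
      \<Rightarrow> ennreal \<Rightarrow> 'w measure \<Rightarrow> bool" where
  "continuously_included_in_Lp \<iota> p N \<longleftrightarrow>
     (\<forall>x. \<iota> x \<in> Lp_space p N) \<and>
     (\<forall>x. ((\<lambda>y. Lp_norm p N (\<lambda>\<omega>. \<iota> y \<omega> - \<iota> x \<omega>)) \<longlongrightarrow> 0) (at x))"


definition integral_pairing ::
    "'w measure \<Rightarrow> ('x \<Rightarrow> 'w \<Rightarrow> 'e::real_normed_vector) \<Rightarrow> ('w \<Rightarrow> 'e \<Rightarrow>\<^sub>L real) \<Rightarrow> 'x \<Rightarrow> real" where
  "integral_pairing M \<iota> xs x = (\<integral>\<omega>. blinfun_apply (xs \<omega>) (\<iota> x \<omega>) \<partial>M)"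

text \<open>Membership in the intersection of the dual of \<open>'x\<close> with \<open>L\<^sub>0(\<Omega>, E\<^sup>*)\<close>, where the dual of \<open>E\<close>
  carries its weak star topology: \<open>xs\<close> is scalarly measurable.\<close>

definition in_dual_L0 ::
    "'w measure \<Rightarrow> ('x::real_normed_vector \<Rightarrow> 'w \<Rightarrow> 'e::real_normed_vector)
      \<Rightarrow> ('w \<Rightarrow> 'e \<Rightarrow>\<^sub>L real) \<Rightarrow> bool" where
  "in_dual_L0 M \<iota> xs \<longleftrightarrow>
     (\<forall>e. (\<lambda>\<omega>. blinfun_apply (xs \<omega>) e) \<in> borel_measurable M) \<and>
     (\<forall>x. integrable M (\<lambda>\<omega>. blinfun_apply (xs \<omega>) (\<iota> x \<omega>))) \<and>
     bounded_linear (integral_pairing M \<iota> xs)"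


definition frechet_subderivative ::
    "('y::real_normed_vector \<Rightarrow> ereal) \<Rightarrow> 'y \<Rightarrow> ('y \<Rightarrow> real) \<Rightarrow> bool" where
  "frechet_subderivative J y0 ys \<longleftrightarrow>
     \<bar>J y0\<bar> \<noteq> \<infinity> \<and> bounded_linear ys \<and>
     0 \<le> Liminf (at y0) (\<lambda>y. (J y - J y0 - ereal (ys (y - y0))) / ereal (norm (y - y0)))"

definition frechet_subderivative_along ::
    "'w measure \<Rightarrow> ('w \<Rightarrow> 'e::real_normed_vector \<Rightarrow> ereal) \<Rightarrow> ('w \<Rightarrow> 'e) \<Rightarrow> ('w \<Rightarrow> 'e \<Rightarrow>\<^sub>L real) \<Rightarrow> bool" where
  "frechet_subderivative_along M f x0 xs \<longleftrightarrow>
     (AE \<omega> in M. frechet_subderivative (f \<omega>) (x0 \<omega>) (blinfun_apply (xs \<omega>)))"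


definition uniformly_integrable :: "'w measure \<Rightarrow> ('w \<Rightarrow> real) set \<Rightarrow> bool" where
  "uniformly_integrable M U \<longleftrightarrow>
     (\<forall>u\<in>U. integrable M u) \<and>
     (SUP u\<in>U. \<integral>\<^sup>+ \<omega>. ennreal \<bar>u \<omega>\<bar> \<partial>M) < \<infinity> \<and>
     (\<forall>\<epsilon>>0. \<exists>\<eta>>0. \<exists>K\<in>sets M. emeasure M K < \<infinity> \<and>
        (\<forall>A\<in>sets M. emeasure M A \<le> ennreal \<eta> \<longrightarrow>
           (SUP u\<in>U. \<integral>\<^sup>+ \<omega>\<in>A. ennreal \<bar>u \<omega>\<bar> \<partial>M) < ennreal \<epsilon>) \<and>
        (SUP u\<in>U. \<integral>\<^sup>+ \<omega>\<in>space M - K. ennreal \<bar>u \<omega>\<bar> \<partial>M) < ennreal \<epsilon>)"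

definition difference_quotient ::
    "('w \<Rightarrow> 'e::real_vector \<Rightarrow> ereal) \<Rightarrow> ('w \<Rightarrow> 'e) \<Rightarrow> real \<Rightarrow> ('w \<Rightarrow> 'e) \<Rightarrow> 'w \<Rightarrow> ereal" where
  "difference_quotient g x0 r x \<omega> =
     ereal (inverse r) * (g \<omega> (x0 \<omega> + r *\<^sub>R x \<omega>) - g \<omega> (x0 \<omega>))"

definition negative_part :: "ereal \<Rightarrow> ereal" where
  "negative_part a = max 0 (- a)"

text \<open>Since \<open>real_of_ereal\<close> sends \<open>\<infinity>\<close> to \<open>0\<close>, finiteness almost everywhere has to be required
  separately for the negative parts to be in \<open>L\<^sub>1(\<Omega>, \<real>)\<close>.\<close>

definition frechet_lower_compactness ::
    "'w measure \<Rightarrow> ('x::real_normed_vector \<Rightarrow> 'w \<Rightarrow> 'e::real_vector)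
      \<Rightarrow> ('w \<Rightarrow> 'e \<Rightarrow> ereal) \<Rightarrow> 'x \<Rightarrow> bool" where
  "frechet_lower_compactness M \<iota> g x0 \<longleftrightarrow>
     (\<forall>(r :: nat \<Rightarrow> real) (x :: nat \<Rightarrow> 'x).
        (\<forall>n. 0 < r n) \<longrightarrow> r \<longlonglongrightarrow> 0 \<longrightarrow> bounded (range x) \<longrightarrow>
        (\<exists>n0.
           (\<forall>n\<ge>n0. AE \<omega> in M.
              negative_part (difference_quotient g (\<iota> x0) (r n) (\<iota> (x n)) \<omega>) \<noteq> \<infinity>) \<and>
           uniformly_integrable M
             ((\<lambda>n \<omega>. real_of_ereal
                 (negative_part (difference_quotient g (\<iota> x0) (r n) (\<iota> (x n)) \<omega>))) ` {n0..})))"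

end

theory Submission
  imports Defs
begin

text \<open>Put \<open>g = f - \<langle>x\<^sup>*, \<cdot>\<rangle>\<close>. Because \<open>f(\<cdot>, x\<^sub>0)\<close> turns out to be integrable and the upper integral is additive in
  an integrable summand, the remainder \<open>I\<^sub>f(x\<^sub>0 + z) - I\<^sub>f(x\<^sub>0) - \<langle>x\<^sup>*, z\<rangle>\<close> is the upper integral of
  \<open>\<omega> \<mapsto> g(\<omega>, x\<^sub>0 + z) - g(\<omega>, x\<^sub>0)\<close>, called the increment at \<open>z\<close> below. Assertion (a) says that for every \<open>\<epsilon> > 0\<close>
  the increment at \<open>z\<close> is at least \<open>-\<epsilon> \<parallel>z\<parallel>\<close> for small \<open>z\<close>
  (\<open>frechet_subderivative_iff_increment\<close>).

  (a) implies (b): let \<open>B\<close> be the set where the difference quotient of \<open>g\<close> with step \<open>r\<^sub>n\<close> and direction \<open>x\<^sub>n\<close> is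
  negative. Decomposability allows replacing \<open>x\<^sub>n\<close> by its restriction to \<open>B\<close>, and solidity keeps the
  restrictions bounded, say by \<open>C\<close>. The increment at \<open>r\<^sub>n x\<^sub>n 1\<^sub>B\<close> is \<open>-r\<^sub>n\<close> times the \<open>L\<^sub>1\<close> norm of the negative
  part of the quotient, so (a) bounds that norm by \<open>\<epsilon> C\<close> for large \<open>n\<close>. The negative parts therefore even
  tend to \<open>0\<close> in \<open>L\<^sub>1\<close>, which is more than uniform integrability
  (\<open>negative_part_L1_bound\<close>, \<open>uniformly_integrable_if_L1_null\<close>).

  (b) implies (a): if (a) fails, there are \<open>\<epsilon> > 0\<close> and a sequence \<open>y\<^sub>n\<close> that tends to \<open>0\<close> as fast as desired, with
  increment below \<open>-\<epsilon> \<parallel>y\<^sub>n\<parallel>\<close>. Take \<open>r\<^sub>n = \<parallel>y\<^sub>n\<parallel>\<close> and \<open>x\<^sub>n = y\<^sub>n / r\<^sub>n\<close>. The continuous inclusion in a weighted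
  Lebesgue space enters only through one consequence: small norm means small in measure on sets of
  finite measure (\<open>small_norm_imp_locally_small_in_measure\<close>). It makes \<open>y\<^sub>n\<close> converge to \<open>0\<close> almost everywhere and
  keeps \<open>x\<^sub>n\<close> bounded in measure. Since \<open>x\<^sup>*(\<omega>)\<close> is almost everywhere a Frechet subderivative of \<open>f(\<omega>, \<cdot>)\<close>,
  the negative parts of the quotients are at most \<open>o(1) \<parallel>x\<^sub>n(\<omega>)\<parallel>\<close>, so they tend to \<open>0\<close> locally in
  measure. With (b), Vitali's theorem (\<open>Vitali_L1_null\<close>) turns this into convergence to \<open>0\<close> in \<open>L\<^sub>1\<close>, contradicting
  the lower bound \<open>\<epsilon>\<close> that the increments impose on their \<open>L\<^sub>1\<close> norms.\<close>

section \<open>The upper integral\<close>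

lemma upper_integral_mono_AE:
  assumes "AE \<omega> in M. v \<omega> \<le> w \<omega>"
  shows "upper_integral M v \<le> upper_integral M w"
  unfolding upper_integral_def
proof (rule INF_superset_mono)
  show "{u. integrable M u \<and> (AE \<omega> in M. w \<omega> \<le> ereal (u \<omega>))}
    \<subseteq> {u. integrable M u \<and> (AE \<omega> in M. v \<omega> \<le> ereal (u \<omega>))}"
    using assms by (auto elim: eventually_elim2 intro: order_trans)
qed auto

lemma upper_integral_cong_AE:
  assumes "AE \<omega> in M. v \<omega> = w \<omega>"
  shows "upper_integral M v = upper_integral M w"
  by (rule antisym; rule upper_integral_mono_AE; rule AE_mp[OF assms]) auto

lemma upper_integral_le:
  assumes "integrable M u" "AE \<omega> in M. v \<omega> \<le> ereal (u \<omega>)"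
  shows "upper_integral M v \<le> ereal (integral\<^sup>L M u)"
  unfolding upper_integral_def using assms by (intro INF_lower) auto

lemma upper_integral_ereal:
  assumes "integrable M u"
  shows "upper_integral M (\<lambda>\<omega>. ereal (u \<omega>)) = ereal (integral\<^sup>L M u)"
proof (rule antisym)
  show "ereal (integral\<^sup>L M u) \<le> upper_integral M (\<lambda>\<omega>. ereal (u \<omega>))"
    unfolding upper_integral_def using assms by (intro INF_greatest) (auto intro: integral_mono_AE)
qed (use assms in \<open>auto intro: upper_integral_le\<close>)

text \<open>Translating the majorants by \<open>\<phi>\<close> gives one inequality for every \<open>v\<close>; the other is the same inequality for
  \<open>v + \<phi>\<close> and \<open>-\<phi>\<close>, since \<open>ereal (\<phi> \<omega>)\<close> is finite and cancels even where \<open>v\<close> is infinite.\<close>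

lemma upper_integral_add_integrable:
  assumes \<phi>: "integrable M \<phi>"
  shows "upper_integral M (\<lambda>\<omega>. v \<omega> + ereal (\<phi> \<omega>)) = upper_integral M v + ereal (integral\<^sup>L M \<phi>)"
proof -
  have le: "upper_integral M (\<lambda>\<omega>. v \<omega> + ereal (\<phi> \<omega>)) \<le> upper_integral M v + ereal (integral\<^sup>L M \<phi>)"
    if \<phi>: "integrable M \<phi>" for v \<phi>
  proof -
    have "upper_integral M (\<lambda>\<omega>. v \<omega> + ereal (\<phi> \<omega>)) - ereal (integral\<^sup>L M \<phi>) \<le> upper_integral M v"
      unfolding upper_integral_def[of M v]
    proof (rule INF_greatest)
      fix u assume "u \<in> {u. integrable M u \<and> (AE \<omega> in M. v \<omega> \<le> ereal (u \<omega>))}"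
      then have u: "integrable M u" "AE \<omega> in M. v \<omega> \<le> ereal (u \<omega>)" by auto
      have "AE \<omega> in M. v \<omega> + ereal (\<phi> \<omega>) \<le> ereal (u \<omega> + \<phi> \<omega>)"
        using u(2) by eventually_elim (metis add_right_mono plus_ereal.simps(1))
      then have "upper_integral M (\<lambda>\<omega>. v \<omega> + ereal (\<phi> \<omega>)) \<le> ereal (integral\<^sup>L M (\<lambda>\<omega>. u \<omega> + \<phi> \<omega>))"
        using u \<phi> by (intro upper_integral_le) auto
      then show "upper_integral M (\<lambda>\<omega>. v \<omega> + ereal (\<phi> \<omega>)) - ereal (integral\<^sup>L M \<phi>) \<le> ereal (integral\<^sup>L M u)"
        using u \<phi> by (simp add: ereal_minus_le)
    qed
    then show ?thesis by (simp add: ereal_minus_le)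
  qed
  have "upper_integral M (\<lambda>\<omega>. (v \<omega> + ereal (\<phi> \<omega>)) + ereal (- \<phi> \<omega>))
      \<le> upper_integral M (\<lambda>\<omega>. v \<omega> + ereal (\<phi> \<omega>)) + ereal (integral\<^sup>L M (\<lambda>\<omega>. - \<phi> \<omega>))"
    using \<phi> by (intro le) auto
  moreover have "(v \<omega> + ereal (\<phi> \<omega>)) + ereal (- \<phi> \<omega>) = v \<omega>" for \<omega>
    by (cases "v \<omega>") auto
  ultimately have "upper_integral M v
      \<le> upper_integral M (\<lambda>\<omega>. v \<omega> + ereal (\<phi> \<omega>)) - ereal (integral\<^sup>L M \<phi>)"
    by (simp add: minus_ereal_def)
  then have "upper_integral M v + ereal (integral\<^sup>L M \<phi>) \<le> upper_integral M (\<lambda>\<omega>. v \<omega> + ereal (\<phi> \<omega>))"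
    by (simp add: ereal_le_minus)
  with le[OF \<phi>] show ?thesis by (intro antisym)
qed

text \<open>On a \<open>\<sigma>\<close>-finite space \<open>v\<close> is the increasing limit of its truncations \<open>min v k\<close> to sets of finite measure, and these are
  integrable. This is how an infimum over integrable majorants gives back the
  Lebesgue integral.\<close>

lemma nn_integral_le_if_integrable_minorants_le:
  fixes v :: "'w \<Rightarrow> ennreal" and c :: real
  assumes "sigma_finite_measure M" and v[measurable]: "v \<in> borel_measurable M"
    and le: "\<And>u. integrable M u \<Longrightarrow> (\<And>\<omega>. 0 \<le> u \<omega>) \<Longrightarrow> (\<And>\<omega>. ennreal (u \<omega>) \<le> v \<omega>) \<Longrightarrow> integral\<^sup>L M u \<le> c"
  shows "(\<integral>\<^sup>+ \<omega>. v \<omega> \<partial>M) \<le> ennreal c"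
proof -
  interpret sigma_finite_measure M by fact
  obtain K :: "nat \<Rightarrow> 'w set" where K: "range K \<subseteq> sets M" "(\<Union>k. K k) = space M"
      "\<And>k. emeasure M (K k) \<noteq> \<infinity>" "incseq K"
    using sigma_finite_incseq by blast
  then have [measurable]: "K k \<in> sets M" for k by auto
  define t where "t k \<omega> = min (v \<omega>) (of_nat k) * indicator (K k) \<omega>" for k \<omega>
  have [measurable]: "t k \<in> borel_measurable M" for k unfolding t_def by measurable
  have fin: "t k \<omega> < \<infinity>" for k \<omega>
    by (auto simp: t_def indicator_def min_def less_top[symmetric] top_unique)
  have tv: "t k \<omega> \<le> v \<omega>" for k \<omega> by (auto simp: t_def indicator_def)
  have "(\<integral>\<^sup>+ \<omega>. t k \<omega> \<partial>M) \<le> (\<integral>\<^sup>+ \<omega>. of_nat k * indicator (K k) \<omega> \<partial>M)" for k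
    by (intro nn_integral_mono) (auto simp: t_def indicator_def)
  also have "\<dots> k < \<infinity>" for k
    using K(3)[of k] by (simp add: nn_integral_cmult_indicator ennreal_mult_less_top less_top of_nat_less_top)
  finally have tfin: "(\<integral>\<^sup>+ \<omega>. t k \<omega> \<partial>M) < \<infinity>" for k .
  have eq: "ennreal (enn2real (t k \<omega>)) = t k \<omega>" for k \<omega> using fin by simp
  have int: "integrable M (\<lambda>\<omega>. enn2real (t k \<omega>))" for k
    using tfin[of k] by (intro integrableI_bounded) (auto simp: eq)
  have bound: "(\<integral>\<^sup>+ \<omega>. t k \<omega> \<partial>M) \<le> ennreal c" for k
  proof -
    have "(\<integral>\<^sup>+ \<omega>. t k \<omega> \<partial>M) = ennreal (\<integral>\<omega>. enn2real (t k \<omega>) \<partial>M)"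
      using nn_integral_eq_integral[OF int[of k]] by (simp add: eq)
    also have "\<dots> \<le> ennreal c"
      using int[of k] tv by (intro ennreal_leI le) (auto simp: eq)
    finally show ?thesis .
  qed
  have inc: "incseq t"
  proof (intro incseq_SucI le_funI)
    fix k \<omega>
    have "indicator (K k) \<omega> \<le> (indicator (K (Suc k)) \<omega> :: ennreal)"
      using incseq_SucD[OF K(4), of k] by (auto simp: indicator_def)
    then show "t k \<omega> \<le> t (Suc k) \<omega>"
      unfolding t_def by (intro mult_mono min.mono of_nat_mono) auto
  qed
  have "(\<integral>\<^sup>+ \<omega>. v \<omega> \<partial>M) = (\<integral>\<^sup>+ \<omega>. (SUP k. t k \<omega>) \<partial>M)"
  proof (rule nn_integral_cong)
    fix \<omega> assume "\<omega> \<in> space M"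
    then obtain k0 where k0: "\<omega> \<in> K k0" using K(2) by auto
    show "v \<omega> = (SUP k. t k \<omega>)"
    proof (rule antisym)
      have "v \<omega> \<le> (SUP k. min (v \<omega>) (of_nat k))"
        unfolding inf_min[symmetric] inf_SUP[symmetric] ennreal_SUP_of_nat_eq_top by simp
      also have "\<dots> \<le> (SUP k. t k \<omega>)"
      proof (rule SUP_mono)
        fix k :: nat
        have "\<omega> \<in> K (max k k0)" using k0 K(4) by (meson incseqD max.cobounded2 subsetD)
        then have "min (v \<omega>) (of_nat k) \<le> t (max k k0) \<omega>"
          by (simp add: t_def min.coboundedI2)
        then show "\<exists>m\<in>UNIV. min (v \<omega>) (of_nat k) \<le> t m \<omega>" by blast
      qed
      finally show "v \<omega> \<le> (SUP k. t k \<omega>)" .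
    qed (auto intro: SUP_least tv)
  qed
  also have "\<dots> = (SUP k. \<integral>\<^sup>+ \<omega>. t k \<omega> \<partial>M)"
    using inc by (intro nn_integral_monotone_convergence_SUP) auto
  also have "\<dots> \<le> ennreal c" using bound by (intro SUP_least)
  finally show ?thesis .
qed

text \<open>The negatives of the integrable functions between \<open>0\<close> and \<open>-v\<close> are majorants of \<open>v\<close>. The
  integrability of \<open>v\<close> is thus a consequence of a lower bound for its upper integral.\<close>

lemma nn_integral_uminus_le_if_upper_integral_ge:
  assumes "sigma_finite_measure M" and v[measurable]: "v \<in> borel_measurable M"
    and nonpos: "AE \<omega> in M. v \<omega> \<le> 0"
    and ge: "ereal (- c) \<le> upper_integral M v"
  shows "(\<integral>\<^sup>+ \<omega>. e2ennreal (- v \<omega>) \<partial>M) \<le> ennreal c"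
proof (rule nn_integral_le_if_integrable_minorants_le)
  fix u assume u: "integrable M u" "\<And>\<omega>. 0 \<le> u \<omega>" "\<And>\<omega>. ennreal (u \<omega>) \<le> e2ennreal (- v \<omega>)"
  have "AE \<omega> in M. v \<omega> \<le> ereal (- u \<omega>)"
    using nonpos
  proof eventually_elim
    case (elim \<omega>)
    then have "enn2ereal (ennreal (u \<omega>)) \<le> enn2ereal (e2ennreal (- v \<omega>))"
      using u(3)[of \<omega>] by (simp add: less_eq_ennreal.rep_eq)
    then have "ereal (u \<omega>) \<le> - v \<omega>"
      using u(2)[of \<omega>] elim by (simp add: enn2ereal_e2ennreal)
    then show ?case by (cases "v \<omega>") auto
  qed
  then have "upper_integral M v \<le> ereal (integral\<^sup>L M (\<lambda>\<omega>. - u \<omega>))"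
    using u(1) by (intro upper_integral_le) auto
  with ge have "ereal (- c) \<le> ereal (- integral\<^sup>L M u)" using u(1) by (metis integral_minus order_trans)
  then show "integral\<^sup>L M u \<le> c" by simp
qed (use assms in auto)

text \<open>Some integrable \<open>u\<close> majorizes \<open>v\<close>, so \<open>v - u\<close> is nonpositive with finite upper integral, and the previous
  bound applies to it.\<close>

lemma integrable_if_finite_upper_integral:
  assumes "sigma_finite_measure M" and v[measurable]: "v \<in> borel_measurable M"
    and fin: "\<bar>upper_integral M v\<bar> \<noteq> \<infinity>"
  obtains \<phi> where "integrable M \<phi>" "AE \<omega> in M. v \<omega> = ereal (\<phi> \<omega>)"
proof -
  have "upper_integral M v < \<infinity>" using fin by auto
  then obtain u where u: "integrable M u" "AE \<omega> in M. v \<omega> \<le> ereal (u \<omega>)"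
    unfolding upper_integral_def INF_less_iff by auto
  define w where "w \<omega> = v \<omega> + ereal (- u \<omega>)" for \<omega>
  have [measurable]: "u \<in> borel_measurable M" using u by auto
  have [measurable]: "w \<in> borel_measurable M" unfolding w_def by measurable
  have wneg: "AE \<omega> in M. w \<omega> \<le> 0"
    using u(2)
  proof eventually_elim
    case (elim \<omega>)
    then show ?case unfolding w_def by (cases "v \<omega>") auto
  qed
  have "upper_integral M w = upper_integral M v + ereal (- integral\<^sup>L M u)"
    unfolding w_def using upper_integral_add_integrable[of M "\<lambda>\<omega>. - u \<omega>" v] u(1) by simp
  then obtain c where "upper_integral M w = ereal (- c)"
    using fin by (cases "upper_integral M v") (auto, metis minus_minus)
  then have "(\<integral>\<^sup>+ \<omega>. e2ennreal (- w \<omega>) \<partial>M) \<le> ennreal c"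
    using assms(1) wneg by (intro nn_integral_uminus_le_if_upper_integral_ge) auto
  then have wfin: "(\<integral>\<^sup>+ \<omega>. e2ennreal (- w \<omega>) \<partial>M) < \<infinity>"
    using ennreal_less_top le_less_trans by (metis infinity_ennreal_def)
  then have "AE \<omega> in M. e2ennreal (- w \<omega>) \<noteq> \<infinity>" by (intro nn_integral_PInf_AE) auto
  then have ae: "AE \<omega> in M. - w \<omega> = ereal (enn2real (e2ennreal (- w \<omega>)))"
    using u(2)
  proof eventually_elim
    case (elim \<omega>)
    then show ?case
      unfolding w_def
      by (cases "v \<omega>") (auto simp: e2ennreal_ereal)
  qed
  have int: "integrable M (\<lambda>\<omega>. enn2real (e2ennreal (- w \<omega>)))"
  proof (rule integrableI_bounded)
    have "(\<integral>\<^sup>+ \<omega>. ennreal (norm (enn2real (e2ennreal (- w \<omega>)))) \<partial>M) \<le> (\<integral>\<^sup>+ \<omega>. e2ennreal (- w \<omega>) \<partial>M)"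
      by (intro nn_integral_mono) (auto simp: ennreal_enn2real_if)
    with wfin show "(\<integral>\<^sup>+ \<omega>. ennreal (norm (enn2real (e2ennreal (- w \<omega>)))) \<partial>M) < \<infinity>" by auto
  qed measurable
  show thesis
  proof
    show "integrable M (\<lambda>\<omega>. u \<omega> - enn2real (e2ennreal (- w \<omega>)))" using int u by auto
    show "AE \<omega> in M. v \<omega> = ereal (u \<omega> - enn2real (e2ennreal (- w \<omega>)))"
      using ae
    proof eventually_elim
      case (elim \<omega>)
      then show ?case unfolding w_def by (cases "v \<omega>") auto
    qed
  qed
qed

section \<open>Uniform integrability and convergence in L1\<close>

lemma sets_superlevel_in_subset:
  assumes K[measurable]: "K \<in> sets M" and [measurable]: "h \<in> borel_measurable M"
  shows "{\<omega>\<in>K. (c::real) < h \<omega>} \<in> sets M"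
proof -
  have "{\<omega>\<in>K. c < h \<omega>} = K \<inter> {\<omega>\<in>space M. c < h \<omega>}"
    using sets.sets_into_space[OF K] by auto
  also have "\<dots> \<in> sets M" by measurable
  finally show ?thesis .
qed

text \<open>Truncate \<open>\<bar>u\<bar>\<close> at height \<open>k\<close> and to the \<open>k\<close>-th set of an exhaustion. The error \<open>d k\<close> tends to \<open>0\<close> in \<open>L\<^sub>1\<close> by dominated
  convergence, and a truncated function satisfies both bounds trivially.\<close>

lemma integrable_absolutely_continuous_tight:
  fixes u :: "'w \<Rightarrow> real"
  assumes "sigma_finite_measure M" and u: "integrable M u" and "0 < \<epsilon>"
  shows "\<exists>\<eta>>0. \<exists>K\<in>sets M. emeasure M K < \<infinity> \<and>
    (\<forall>A\<in>sets M. emeasure M A \<le> ennreal \<eta> \<longrightarrow> (\<integral>\<^sup>+ \<omega>\<in>A. ennreal \<bar>u \<omega>\<bar> \<partial>M) \<le> ennreal \<epsilon>) \<and>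
    (\<integral>\<^sup>+ \<omega>\<in>space M - K. ennreal \<bar>u \<omega>\<bar> \<partial>M) \<le> ennreal \<epsilon>"
proof -
  interpret sigma_finite_measure M by fact
  obtain K :: "nat \<Rightarrow> 'w set" where K: "range K \<subseteq> sets M" "(\<Union>k. K k) = space M"
      "\<And>k. emeasure M (K k) \<noteq> \<infinity>" "incseq K"
    using sigma_finite_incseq by blast
  then have [measurable]: "K k \<in> sets M" for k by auto
  have [measurable]: "u \<in> borel_measurable M" using u by auto
  define d where "d k \<omega> = \<bar>u \<omega>\<bar> - min \<bar>u \<omega>\<bar> (real k) * indicat_real (K k) \<omega>" for k \<omega>
  have [measurable]: "d k \<in> borel_measurable M" for k unfolding d_def by measurable
  have "(\<lambda>k. \<integral>\<^sup>+ \<omega>. ennreal (d k \<omega>) \<partial>M) \<longlonglongrightarrow> (\<integral>\<^sup>+ \<omega>. 0 \<partial>M)"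
  proof (rule nn_integral_dominated_convergence)
    show "AE \<omega> in M. ennreal (d k \<omega>) \<le> ennreal \<bar>u \<omega>\<bar>" for k
      by (auto simp: d_def indicator_def intro!: ennreal_leI AE_I2)
    show "(\<integral>\<^sup>+ \<omega>. ennreal \<bar>u \<omega>\<bar> \<partial>M) < \<infinity>"
      using u unfolding integrable_iff_bounded by simp
    show "AE \<omega> in M. (\<lambda>k. ennreal (d k \<omega>)) \<longlonglongrightarrow> 0"
    proof (rule AE_I2)
      fix \<omega> assume "\<omega> \<in> space M"
      then obtain k0 where "\<omega> \<in> K k0" using K(2) by auto
      moreover obtain k1 :: nat where "\<bar>u \<omega>\<bar> \<le> real k1" using real_arch_simple by blast
      ultimately have "d k \<omega> = 0" if "k \<ge> max k0 k1" for k
        using that incseqD[OF K(4), of k0 k] by (auto simp: d_def min_def indicator_def)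
      then have "eventually (\<lambda>k. ennreal (d k \<omega>) = 0) sequentially"
        by (auto simp: eventually_sequentially intro!: exI[of _ "max k0 k1"])
      then show "(\<lambda>k. ennreal (d k \<omega>)) \<longlonglongrightarrow> 0" by (rule tendsto_eventually)
    qed
  qed auto
  then have "eventually (\<lambda>k. (\<integral>\<^sup>+ \<omega>. ennreal (d k \<omega>) \<partial>M) < ennreal (\<epsilon> / 2)) sequentially"
    using \<open>0 < \<epsilon>\<close> by (intro order_tendstoD(2)[where a = "ennreal (\<epsilon> / 2)"]) auto
  then obtain k where k: "(\<integral>\<^sup>+ \<omega>. ennreal (d k \<omega>) \<partial>M) \<le> ennreal (\<epsilon> / 2)"
    by (auto simp: eventually_sequentially intro: less_imp_le)
  have on: "(\<integral>\<^sup>+ \<omega>\<in>A. ennreal \<bar>u \<omega>\<bar> \<partial>M) \<le> ennreal \<epsilon>"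
    if [measurable]: "A \<in> sets M" and A: "emeasure M A \<le> ennreal (\<epsilon> / (2 * (real k + 1)))" for A
  proof -
    have "(\<integral>\<^sup>+ \<omega>\<in>A. ennreal \<bar>u \<omega>\<bar> \<partial>M)
        \<le> (\<integral>\<^sup>+ \<omega>. ennreal (d k \<omega>) + ennreal (real k + 1) * indicator A \<omega> \<partial>M)"
      by (intro nn_integral_mono)
        (auto simp: d_def indicator_def ennreal_plus[symmetric] simp del: ennreal_plus intro!: ennreal_leI)
    also have "\<dots> = (\<integral>\<^sup>+ \<omega>. ennreal (d k \<omega>) \<partial>M) + ennreal (real k + 1) * emeasure M A"
      by (subst nn_integral_add) (auto simp: nn_integral_cmult_indicator)
    also have "\<dots> \<le> ennreal (\<epsilon> / 2) + ennreal (real k + 1) * ennreal (\<epsilon> / (2 * (real k + 1)))"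
      using k A by (intro add_mono mult_left_mono) auto
    also have "ennreal (real k + 1) * ennreal (\<epsilon> / (2 * (real k + 1)))
        = ennreal ((real k + 1) * (\<epsilon> / (2 * (real k + 1))))"
      using \<open>0 < \<epsilon>\<close> by (intro ennreal_mult[symmetric]) auto
    also have "(real k + 1) * (\<epsilon> / (2 * (real k + 1))) = \<epsilon> / 2"
      by (simp add: field_simps add_nonneg_eq_0_iff)
    also have "ennreal (\<epsilon> / 2) + ennreal (\<epsilon> / 2) = ennreal \<epsilon>"
      using \<open>0 < \<epsilon>\<close> by (simp add: ennreal_plus[symmetric] del: ennreal_plus)
    finally show ?thesis .
  qed
  have "(\<integral>\<^sup>+ \<omega>\<in>space M - K k. ennreal \<bar>u \<omega>\<bar> \<partial>M) \<le> (\<integral>\<^sup>+ \<omega>. ennreal (d k \<omega>) \<partial>M)"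
    by (intro nn_integral_mono) (auto simp: d_def indicator_def)
  also have "\<dots> \<le> ennreal \<epsilon>"
    using k \<open>0 < \<epsilon>\<close> by (auto intro: order_trans[OF _ ennreal_leI])
  finally have off: "(\<integral>\<^sup>+ \<omega>\<in>space M - K k. ennreal \<bar>u \<omega>\<bar> \<partial>M) \<le> ennreal \<epsilon>" .
  show ?thesis
  proof (intro exI[of _ "\<epsilon> / (2 * (real k + 1))"] conjI bexI[of _ "K k"] ballI impI)
    show "0 < \<epsilon> / (2 * (real k + 1))" using \<open>0 < \<epsilon>\<close> by auto
    show "emeasure M (K k) < \<infinity>" using K(3)[of k] by (simp add: less_top)
  qed (fact on off | simp)+
qed

text \<open>All but finitely many members have \<open>L\<^sub>1\<close> norm below \<open>\<epsilon> / 2\<close>. For the remaining ones take the least of their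
  \<open>\<eta>\<close> and the union of their sets \<open>K\<close>.\<close>

lemma uniformly_integrable_if_L1_null:
  fixes u :: "nat \<Rightarrow> 'w \<Rightarrow> real"
  assumes sf: "sigma_finite_measure M" and int: "\<And>n. n \<ge> n0 \<Longrightarrow> integrable M (u n)"
    and null: "\<And>\<epsilon>. 0 < \<epsilon> \<Longrightarrow> \<forall>\<^sub>F n in sequentially. (\<integral>\<^sup>+ \<omega>. ennreal \<bar>u n \<omega>\<bar> \<partial>M) \<le> ennreal \<epsilon>"
  shows "uniformly_integrable M (u ` {n0..})"
  unfolding uniformly_integrable_def
proof (intro conjI allI impI)
  show "\<forall>v\<in>u ` {n0..}. integrable M v" using int by auto
  obtain N where N: "(\<integral>\<^sup>+ \<omega>. ennreal \<bar>u n \<omega>\<bar> \<partial>M) \<le> ennreal 1" if "n \<ge> N" for n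
    using null[of 1] by (auto simp: eventually_sequentially)
  have fin: "(\<integral>\<^sup>+ \<omega>. ennreal \<bar>u n \<omega>\<bar> \<partial>M) < \<infinity>" if "n \<ge> n0" for n
    using int[OF that] unfolding integrable_iff_bounded by simp
  have "(SUP v\<in>u ` {n0..}. \<integral>\<^sup>+ \<omega>. ennreal \<bar>v \<omega>\<bar> \<partial>M)
      \<le> 1 + (\<Sum>n\<in>{n0..<N}. \<integral>\<^sup>+ \<omega>. ennreal \<bar>u n \<omega>\<bar> \<partial>M)"
  proof (rule SUP_least, clarsimp)
    fix n assume n: "n0 \<le> n"
    show "(\<integral>\<^sup>+ \<omega>. ennreal \<bar>u n \<omega>\<bar> \<partial>M) \<le> 1 + (\<Sum>n\<in>{n0..<N}. \<integral>\<^sup>+ \<omega>. ennreal \<bar>u n \<omega>\<bar> \<partial>M)"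
    proof (cases "n < N")
      case True
      with n have "(\<integral>\<^sup>+ \<omega>. ennreal \<bar>u n \<omega>\<bar> \<partial>M) \<le> (\<Sum>n\<in>{n0..<N}. \<integral>\<^sup>+ \<omega>. ennreal \<bar>u n \<omega>\<bar> \<partial>M)"
        by (intro member_le_sum) auto
      then show ?thesis by (simp add: add_increasing)
    next
      case False
      then show ?thesis using N[of n] by (simp add: add_increasing2)
    qed
  qed
  also have "\<dots> < \<infinity>" using fin by (auto simp: less_top[symmetric])
  finally show "(SUP v\<in>u ` {n0..}. \<integral>\<^sup>+ \<omega>. ennreal \<bar>v \<omega>\<bar> \<partial>M) < \<infinity>" .
next
  fix \<epsilon> :: real assume "0 < \<epsilon>"
  obtain N where N: "(\<integral>\<^sup>+ \<omega>. ennreal \<bar>u n \<omega>\<bar> \<partial>M) \<le> ennreal (\<epsilon> / 2)" if "n \<ge> N" for n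
    using null[of "\<epsilon> / 2"] \<open>0 < \<epsilon>\<close> by (auto simp: eventually_sequentially)
  have part: "(\<integral>\<^sup>+ \<omega>\<in>A. ennreal \<bar>u n \<omega>\<bar> \<partial>M) \<le> ennreal (\<epsilon> / 2)" if "n \<ge> N" for n A
    by (rule order_trans[OF nn_integral_mono N[OF that]]) (auto simp: indicator_def)
  define good where "good n \<eta> K \<longleftrightarrow> 0 < \<eta> \<and> K \<in> sets M \<and> emeasure M K < \<infinity> \<and>
      (\<forall>A\<in>sets M. emeasure M A \<le> ennreal \<eta> \<longrightarrow> (\<integral>\<^sup>+ \<omega>\<in>A. ennreal \<bar>u n \<omega>\<bar> \<partial>M) \<le> ennreal (\<epsilon> / 2)) \<and>
      (\<integral>\<^sup>+ \<omega>\<in>space M - K. ennreal \<bar>u n \<omega>\<bar> \<partial>M) \<le> ennreal (\<epsilon> / 2)" for n \<eta> K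
  have "\<exists>\<eta> K. good n \<eta> K" if "n \<ge> n0" for n
    using integrable_absolutely_continuous_tight[OF sf int[OF that], of "\<epsilon> / 2"] \<open>0 < \<epsilon>\<close>
    unfolding good_def by auto
  then obtain \<eta> K where good: "\<And>n. n \<ge> n0 \<Longrightarrow> good n (\<eta> n) (K n)"
    by metis
  note \<eta>K = good[unfolded good_def]
  define \<eta>' where "\<eta>' = Min (insert 1 (\<eta> ` {n0..<N}))"
  define K' where "K' = (\<Union>n\<in>{n0..<N}. K n)"
  have \<eta>': "0 < \<eta>'" "\<And>n. n0 \<le> n \<Longrightarrow> n < N \<Longrightarrow> \<eta>' \<le> \<eta> n"
    unfolding \<eta>'_def using \<eta>K by (simp, intro Min_le) auto
  have K': "K' \<in> sets M" unfolding K'_def using \<eta>K by auto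
  have "emeasure M K' \<le> (\<Sum>n\<in>{n0..<N}. emeasure M (K n))"
    unfolding K'_def using \<eta>K by (intro emeasure_subadditive_finite) auto
  also have "\<dots> < \<infinity>" using \<eta>K by (auto simp: less_top[symmetric])
  finally have finK': "emeasure M K' < \<infinity>" .
  have half: "ennreal (\<epsilon> / 2) < ennreal \<epsilon>" using \<open>0 < \<epsilon>\<close> by (simp add: ennreal_less_iff)
  show "\<exists>\<eta>>0. \<exists>K\<in>sets M. emeasure M K < \<infinity> \<and>
      (\<forall>A\<in>sets M. emeasure M A \<le> ennreal \<eta> \<longrightarrow>
        (SUP v\<in>u ` {n0..}. \<integral>\<^sup>+ \<omega>\<in>A. ennreal \<bar>v \<omega>\<bar> \<partial>M) < ennreal \<epsilon>) \<and>
      (SUP v\<in>u ` {n0..}. \<integral>\<^sup>+ \<omega>\<in>space M - K. ennreal \<bar>v \<omega>\<bar> \<partial>M) < ennreal \<epsilon>"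
  proof (intro exI[of _ \<eta>'] bexI[of _ K'] conjI ballI impI)
    fix A assume A: "A \<in> sets M" "emeasure M A \<le> ennreal \<eta>'"
    have "(\<integral>\<^sup>+ \<omega>\<in>A. ennreal \<bar>u n \<omega>\<bar> \<partial>M) \<le> ennreal (\<epsilon> / 2)" if n: "n \<ge> n0" for n
    proof (cases "n < N")
      case True
      then have "emeasure M A \<le> ennreal (\<eta> n)"
        using A(2) \<eta>'(2)[OF n True] by (meson ennreal_leI order_trans)
      then show ?thesis using \<eta>K[OF n] A by blast
    qed (use part in auto)
    then show "(SUP v\<in>u ` {n0..}. \<integral>\<^sup>+ \<omega>\<in>A. ennreal \<bar>v \<omega>\<bar> \<partial>M) < ennreal \<epsilon>"
      by (intro le_less_trans[OF _ half] SUP_least) auto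
  next
    have "(\<integral>\<^sup>+ \<omega>\<in>space M - K'. ennreal \<bar>u n \<omega>\<bar> \<partial>M) \<le> ennreal (\<epsilon> / 2)" if n: "n \<ge> n0" for n
    proof (cases "n < N")
      case True
      have "(\<integral>\<^sup>+ \<omega>\<in>space M - K'. ennreal \<bar>u n \<omega>\<bar> \<partial>M) \<le> (\<integral>\<^sup>+ \<omega>\<in>space M - K n. ennreal \<bar>u n \<omega>\<bar> \<partial>M)"
        using n True by (intro nn_integral_mono) (auto simp: K'_def indicator_def)
      then show ?thesis using \<eta>K[OF n] by (meson order_trans)
    qed (use part in auto)
    then show "(SUP v\<in>u ` {n0..}. \<integral>\<^sup>+ \<omega>\<in>space M - K'. ennreal \<bar>v \<omega>\<bar> \<partial>M) < ennreal \<epsilon>"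
      by (intro le_less_trans[OF _ half] SUP_least) auto
  qed (use \<eta>' K' finK' in auto)
qed

text \<open>The half of Vitali's convergence theorem that is needed: outside \<open>K\<close>, and on the part of \<open>K\<close> where \<open>\<bar>u n\<bar>\<close> exceeds
  \<open>\<delta>\<close>, uniform integrability makes the integral small; on the rest of \<open>K\<close> it is at most \<open>\<delta> \<mu>(K)\<close>.\<close>

lemma Vitali_L1_null:
  fixes u :: "nat \<Rightarrow> 'w \<Rightarrow> real"
  assumes ui: "uniformly_integrable M (u ` {n0..})"
    and null: "\<And>K \<delta> \<eta>. K \<in> sets M \<Longrightarrow> emeasure M K < \<infinity> \<Longrightarrow> 0 < \<delta> \<Longrightarrow> 0 < \<eta> \<Longrightarrow>
      \<forall>\<^sub>F n in sequentially. emeasure M {\<omega>\<in>K. \<delta> < \<bar>u n \<omega>\<bar>} \<le> ennreal \<eta>"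
    and "0 < \<epsilon>"
  shows "\<forall>\<^sub>F n in sequentially. (\<integral>\<^sup>+ \<omega>. ennreal \<bar>u n \<omega>\<bar> \<partial>M) \<le> ennreal \<epsilon>"
proof -
  have "0 < \<epsilon> / 3" using \<open>0 < \<epsilon>\<close> by simp
  then obtain \<eta> K where \<eta>: "0 < \<eta>" and K[measurable]: "K \<in> sets M" and Kfin: "emeasure M K < \<infinity>"
    and on: "\<And>A. A \<in> sets M \<Longrightarrow> emeasure M A \<le> ennreal \<eta> \<Longrightarrow>
        (SUP v\<in>u ` {n0..}. \<integral>\<^sup>+ \<omega>\<in>A. ennreal \<bar>v \<omega>\<bar> \<partial>M) < ennreal (\<epsilon> / 3)"
    and off: "(SUP v\<in>u ` {n0..}. \<integral>\<^sup>+ \<omega>\<in>space M - K. ennreal \<bar>v \<omega>\<bar> \<partial>M) < ennreal (\<epsilon> / 3)"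
    using ui unfolding uniformly_integrable_def by meson
  \<comment> \<open>The summand \<open>1\<close> keeps the denominator positive when \<open>K\<close> is a null set.\<close>
  define \<delta> where "\<delta> = \<epsilon> / (3 * (measure M K + 1))"
  have pos: "0 < measure M K + 1" by (simp add: add_nonneg_pos)
  have "0 < \<delta>" unfolding \<delta>_def using \<open>0 < \<epsilon>\<close> pos by simp
  have "ennreal \<delta> * emeasure M K = ennreal (\<delta> * measure M K)"
    using Kfin \<open>0 < \<delta>\<close> by (simp add: emeasure_eq_ennreal_measure ennreal_mult)
  also have "\<dots> \<le> ennreal (\<epsilon> / 3)"
  proof (rule ennreal_leI)
    have "\<delta> * measure M K \<le> \<delta> * (measure M K + 1)" using \<open>0 < \<delta>\<close> by (intro mult_left_mono) auto
    also have "\<dots> = \<epsilon> / 3" unfolding \<delta>_def using pos by (simp add: field_simps)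
    finally show "\<delta> * measure M K \<le> \<epsilon> / 3" .
  qed
  finally have \<delta>K: "ennreal \<delta> * emeasure M K \<le> ennreal (\<epsilon> / 3)" .
  show ?thesis
    using null[OF K Kfin \<open>0 < \<delta>\<close> \<eta>] eventually_ge_at_top[of n0]
  proof eventually_elim
    case (elim n)
    have [measurable]: "u n \<in> borel_measurable M"
      using ui elim(2) unfolding uniformly_integrable_def by auto
    define A where "A = {\<omega>\<in>K. \<delta> < \<bar>u n \<omega>\<bar>}"
    have [measurable]: "A \<in> sets M"
      unfolding A_def by (intro sets_superlevel_in_subset K) measurable
    have "(\<integral>\<^sup>+ \<omega>. ennreal \<bar>u n \<omega>\<bar> \<partial>M) \<le> (\<integral>\<^sup>+ \<omega>. (ennreal \<bar>u n \<omega>\<bar> * indicator A \<omega>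
        + ennreal \<bar>u n \<omega>\<bar> * indicator (space M - K) \<omega>) + ennreal \<delta> * indicator K \<omega> \<partial>M)"
      by (intro nn_integral_mono) (auto simp: A_def indicator_def intro: ennreal_leI)
    also have "\<dots> = (\<integral>\<^sup>+ \<omega>\<in>A. ennreal \<bar>u n \<omega>\<bar> \<partial>M) + (\<integral>\<^sup>+ \<omega>\<in>space M - K. ennreal \<bar>u n \<omega>\<bar> \<partial>M)
        + ennreal \<delta> * emeasure M K"
      by (subst nn_integral_add, measurable)+ (simp add: nn_integral_cmult_indicator)
    also have "\<dots> \<le> ennreal (\<epsilon> / 3) + ennreal (\<epsilon> / 3) + ennreal (\<epsilon> / 3)"
    proof (intro add_mono \<delta>K)
      show "(\<integral>\<^sup>+ \<omega>\<in>A. ennreal \<bar>u n \<omega>\<bar> \<partial>M) \<le> ennreal (\<epsilon> / 3)"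
        using elim by (intro order_trans[OF SUP_upper less_imp_le[OF on]]) (auto simp: A_def)
      show "(\<integral>\<^sup>+ \<omega>\<in>space M - K. ennreal \<bar>u n \<omega>\<bar> \<partial>M) \<le> ennreal (\<epsilon> / 3)"
        using elim by (intro order_trans[OF SUP_upper less_imp_le[OF off]]) auto
    qed
    also have "\<dots> = ennreal \<epsilon>"
      using \<open>0 < \<epsilon>\<close> by (simp add: ennreal_plus[symmetric] del: ennreal_plus)
    finally show ?case .
  qed
qed

section \<open>Lebesgue spaces and convergence in measure\<close>

lemma Lp_norm_cong_AE:
  assumes "x \<in> borel_measurable N" "y \<in> borel_measurable N" "AE \<omega> in N. x \<omega> = y \<omega>"
  shows "Lp_norm p N x = Lp_norm p N y"
proof -
  have "esssup N (\<lambda>\<omega>. ennreal (norm (x \<omega>))) = esssup N (\<lambda>\<omega>. ennreal (norm (y \<omega>)))"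
    using assms by (intro esssup_AE_cong) auto
  moreover have "(\<integral>\<^sup>+ \<omega>. ennreal (norm (x \<omega>) powr enn2real p) \<partial>N) = (\<integral>\<^sup>+ \<omega>. ennreal (norm (y \<omega>) powr enn2real p) \<partial>N)"
    using assms by (intro nn_integral_cong_AE) auto
  ultimately show ?thesis unfolding Lp_norm_def by simp
qed

text \<open>Markov's inequality for finite \<open>p\<close>; for \<open>p = \<infinity>\<close> a function with norm below \<open>\<delta>\<close> does not exceed \<open>\<delta>\<close> at all, up to a null
  set.\<close>

lemma Lp_norm_small_imp_small_in_measure:
  assumes "1 \<le> p" "0 < \<delta>" "0 < \<eta>"
  shows "\<exists>t>0. \<forall>x\<in>Lp_space p N. Lp_norm p N x < t \<longrightarrow>
    emeasure N {\<omega>\<in>space N. \<delta> < norm (x \<omega>)} \<le> ennreal \<eta>"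
proof (cases "p = \<infinity>")
  case True
  show ?thesis
  proof (intro exI[of _ \<delta>] conjI ballI impI \<open>0 < \<delta>\<close>)
    fix x assume x: "x \<in> Lp_space p N" "Lp_norm p N x < \<delta>"
    have [measurable]: "x \<in> borel_measurable N" using x by (auto simp: Lp_space_def)
    have fin: "esssup N (\<lambda>\<omega>. ennreal (norm (x \<omega>))) < \<infinity>"
      using x True by (simp add: Lp_space_def)
    have "AE \<omega> in N. \<not> \<delta> < norm (x \<omega>)"
      using esssup_AE[of "\<lambda>\<omega>. ennreal (norm (x \<omega>))" N]
    proof eventually_elim
      case (elim \<omega>)
      then have "norm (x \<omega>) \<le> enn2real (esssup N (\<lambda>\<omega>. ennreal (norm (x \<omega>))))"
        using fin enn2real_mono by fastforce
      then show ?case using x(2) True by (simp add: Lp_norm_def)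
    qed
    then have "emeasure N {\<omega>\<in>space N. \<delta> < norm (x \<omega>)} = 0"
      by (subst (asm) AE_iff_measurable[OF _ refl]) auto
    then show "emeasure N {\<omega>\<in>space N. \<delta> < norm (x \<omega>)} \<le> ennreal \<eta>" by simp
  qed
next
  case False
  define q where "q = enn2real p"
  have "1 \<le> q"
    using enn2real_mono[of 1 p] \<open>1 \<le> p\<close> False by (simp add: q_def less_top)
  define t where "t = (\<delta> powr q * \<eta>) powr (1 / q)"
  show ?thesis
  proof (intro exI[of _ t] conjI ballI impI)
    show "0 < t" using assms by (simp add: t_def)
    fix x assume x: "x \<in> Lp_space p N" "Lp_norm p N x < t"
    have [measurable]: "x \<in> borel_measurable N" using x by (auto simp: Lp_space_def)
    define I where "I = (\<integral>\<^sup>+ \<omega>. ennreal (norm (x \<omega>) powr q) \<partial>N)"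
    have I: "I < \<infinity>" using x False by (simp add: Lp_space_def I_def q_def)
    have "enn2real I powr (1 / q) < (\<delta> powr q * \<eta>) powr (1 / q)"
      using x(2) False by (simp add: Lp_norm_def I_def q_def t_def)
    then have "enn2real I \<le> \<delta> powr q * \<eta>"
      using \<open>1 \<le> q\<close> assms by (meson enn2real_nonneg linorder_not_le order_less_imp_le powr_mono2 zero_le_divide_1_iff
          order_trans zero_le_one mult_nonneg_nonneg powr_ge_zero)
    then have I_le: "I \<le> ennreal (\<delta> powr q * \<eta>)"
      using I by (metis ennreal_enn2real ennreal_leI infinity_ennreal_def)
    have "{\<omega>\<in>space N. \<delta> < norm (x \<omega>)}
        \<subseteq> {\<omega>\<in>space N. 1 \<le> ennreal (1 / \<delta> powr q) * ennreal (norm (x \<omega>) powr q)}"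
    proof clarsimp
      fix \<omega> assume "\<delta> < norm (x \<omega>)"
      then have "\<delta> powr q \<le> norm (x \<omega>) powr q" using assms \<open>1 \<le> q\<close> by (intro powr_mono2) auto
      then show "1 \<le> ennreal (1 / \<delta> powr q) * ennreal (norm (x \<omega>) powr q)"
        using assms by (simp add: ennreal_mult[symmetric])
    qed
    then have "emeasure N {\<omega>\<in>space N. \<delta> < norm (x \<omega>)}
        \<le> emeasure N {\<omega>\<in>space N. 1 \<le> ennreal (1 / \<delta> powr q) * ennreal (norm (x \<omega>) powr q)}"
      by (intro emeasure_mono) auto
    also have "\<dots> \<le> ennreal (1 / \<delta> powr q) * (\<integral>\<^sup>+ \<omega>. ennreal (norm (x \<omega>) powr q) * indicator (space N) \<omega> \<partial>N)"
      by (intro nn_integral_Markov_inequality) auto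
    also have "(\<integral>\<^sup>+ \<omega>. ennreal (norm (x \<omega>) powr q) * indicator (space N) \<omega> \<partial>N) = I"
      unfolding I_def by (intro nn_integral_cong) auto
    also have "ennreal (1 / \<delta> powr q) * I \<le> ennreal (1 / \<delta> powr q) * ennreal (\<delta> powr q * \<eta>)"
      by (intro mult_left_mono I_le) auto
    also have "\<dots> = ennreal \<eta>"
      using assms by (simp add: ennreal_mult[symmetric])
    finally show "emeasure N {\<omega>\<in>space N. \<delta> < norm (x \<omega>)} \<le> ennreal \<eta>" .
  qed
qed

text \<open>The weight may come arbitrarily close to \<open>0\<close>, so smallness for \<open>\<beta>\<mu>\<close> passes to \<open>\<mu>\<close> only on sets of
  finite measure: there \<open>\<beta>\<close> is bounded below off a subset \<open>L k\<close> of small measure.\<close>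

lemma emeasure_density_positive_absolutely_continuous:
  fixes \<beta> :: "'w \<Rightarrow> real"
  assumes \<beta>[measurable]: "\<beta> \<in> borel_measurable M" and pos: "\<forall>\<omega>\<in>space M. 0 < \<beta> \<omega>"
    and K[measurable]: "K \<in> sets M" and Kfin: "emeasure M K < \<infinity>" and "0 < \<eta>"
  shows "\<exists>\<theta>>0. \<forall>A\<in>sets M. emeasure (density M (\<lambda>\<omega>. ennreal (\<beta> \<omega>))) A \<le> ennreal \<theta> \<longrightarrow>
    emeasure M (K \<inter> A) \<le> ennreal \<eta>"
proof -
  define L where "L k = {\<omega>\<in>space M. \<omega> \<in> K \<and> \<beta> \<omega> < 1 / (real k + 1)}" for k
  have Lm[measurable]: "L k \<in> sets M" for k unfolding L_def by measurable
  have "(\<lambda>k. emeasure M (L k)) \<longlonglongrightarrow> emeasure M (\<Inter>k. L k)"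
  proof (rule Lim_emeasure_decseq)
    show "decseq L"
    proof (rule decseq_SucI)
      fix k
      have "1 / (real (Suc k) + 1) \<le> 1 / (real k + 1)" by (simp add: field_simps)
      then show "L (Suc k) \<subseteq> L k" unfolding L_def by auto
    qed
    have "emeasure M (L k) \<le> emeasure M K" for k
      by (intro emeasure_mono) (auto simp: L_def)
    then show "emeasure M (L k) \<noteq> \<infinity>" for k
      using Kfin by (metis infinity_ennreal_def leD)
  qed (use Lm in auto)
  moreover have "(\<Inter>k. L k) = {}"
  proof (rule ccontr)
    assume "(\<Inter>k. L k) \<noteq> {}"
    then obtain \<omega> where \<omega>: "\<And>k. \<omega> \<in> L k" by auto
    then have "0 < \<beta> \<omega>" using pos by (auto simp: L_def)
    then obtain k where "inverse (real (Suc k)) < \<beta> \<omega>" using reals_Archimedean by blast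
    then show False using \<omega>[of k] by (simp add: L_def inverse_eq_divide add.commute)
  qed
  ultimately have "(\<lambda>k. emeasure M (L k)) \<longlonglongrightarrow> 0" by simp
  then have "eventually (\<lambda>k. emeasure M (L k) < ennreal (\<eta> / 2)) sequentially"
    using \<open>0 < \<eta>\<close> by (intro order_tendstoD(2)) auto
  then obtain k where k: "emeasure M (L k) \<le> ennreal (\<eta> / 2)"
    by (auto simp: eventually_sequentially intro: less_imp_le)
  \<comment> \<open>On the part of \<open>A\<close> where \<open>\<beta>\<close> is at least \<open>1 / (k + 1)\<close>, the measure is at most \<open>(k + 1)\<close> times the weighted one.\<close>
  define \<theta> where "\<theta> = \<eta> / 2 / (real k + 1)"
  show ?thesis
  proof (intro exI[of _ \<theta>] conjI ballI impI)
    show "0 < \<theta>" using \<open>0 < \<eta>\<close> by (simp add: \<theta>_def)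
    fix A assume A[measurable]: "A \<in> sets M"
      and A_le: "emeasure (density M (\<lambda>\<omega>. ennreal (\<beta> \<omega>))) A \<le> ennreal \<theta>"
    have "emeasure M (K \<inter> A) \<le> emeasure M (L k \<union> (A \<inter> {\<omega>\<in>space M. 1 / (real k + 1) \<le> \<beta> \<omega>}))"
      using sets.sets_into_space[OF K] by (intro emeasure_mono) (auto simp: L_def)
    also have "\<dots> \<le> emeasure M (L k) + emeasure M (A \<inter> {\<omega>\<in>space M. 1 / (real k + 1) \<le> \<beta> \<omega>})"
      by (intro emeasure_subadditive) auto
    also have "emeasure M (A \<inter> {\<omega>\<in>space M. 1 / (real k + 1) \<le> \<beta> \<omega>})
        = (\<integral>\<^sup>+ \<omega>. indicator (A \<inter> {\<omega>\<in>space M. 1 / (real k + 1) \<le> \<beta> \<omega>}) \<omega> \<partial>M)"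
      by (intro nn_integral_indicator[symmetric]) measurable
    also have "\<dots> \<le> (\<integral>\<^sup>+ \<omega>. ennreal (real k + 1) * (ennreal (\<beta> \<omega>) * indicator A \<omega>) \<partial>M)"
    proof (intro nn_integral_mono)
      fix \<omega> assume "\<omega> \<in> space M"
      show "indicator (A \<inter> {\<omega>\<in>space M. 1 / (real k + 1) \<le> \<beta> \<omega>}) \<omega>
          \<le> ennreal (real k + 1) * (ennreal (\<beta> \<omega>) * indicator A \<omega>)"
      proof (cases "1 / (real k + 1) \<le> \<beta> \<omega>")
        case True
        then have "1 \<le> (real k + 1) * \<beta> \<omega>" by (simp add: field_simps)
        then have "1 \<le> ennreal (real k + 1) * ennreal (\<beta> \<omega>)"
          by (metis ennreal_1 ennreal_leI ennreal_mult' of_nat_0_le_iff add_nonneg_nonneg zero_le_one)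
        then show ?thesis by (auto simp: indicator_def)
      qed (auto simp: indicator_def)
    qed
    also have "\<dots> = ennreal (real k + 1) * emeasure (density M (\<lambda>\<omega>. ennreal (\<beta> \<omega>))) A"
      by (simp add: nn_integral_cmult emeasure_density)
    also have "\<dots> \<le> ennreal (real k + 1) * ennreal \<theta>"
      by (intro mult_left_mono A_le) auto
    also have "\<dots> = ennreal ((real k + 1) * \<theta>)"
      using \<open>0 < \<theta>\<close> by (intro ennreal_mult[symmetric]) auto
    also have "(real k + 1) * \<theta> = \<eta> / 2" by (simp add: \<theta>_def field_simps add_nonneg_eq_0_iff)
    also have "emeasure M (L k) + ennreal (\<eta> / 2) \<le> ennreal (\<eta> / 2) + ennreal (\<eta> / 2)"
      by (intro add_mono k) auto
    also have "\<dots> = ennreal \<eta>"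
      using \<open>0 < \<eta>\<close> by (simp add: ennreal_plus[symmetric] del: ennreal_plus)
    finally show "emeasure M (K \<inter> A) \<le> ennreal \<eta>" by simp
  qed
qed

text \<open>This is continuity at \<open>0\<close> of the inclusion in the space of measurable functions with local convergence in
  measure, and all that the proof takes from the Lebesgue space.\<close>

lemma small_norm_imp_locally_small_in_measure:
  fixes \<iota> :: "'x::real_normed_vector \<Rightarrow> 'w \<Rightarrow> 'e::{banach, second_countable_topology}"
  assumes L0: "normed_L0_subspace M \<iota>" and p: "1 \<le> p" and \<beta>: "\<beta> \<in> borel_measurable M"
    and pos: "\<forall>\<omega>\<in>space M. 0 < \<beta> \<omega>"
    and incl: "continuously_included_in_Lp \<iota> p (density M (\<lambda>\<omega>. ennreal (\<beta> \<omega>)))"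
    and K: "K \<in> sets M" "emeasure M K < \<infinity>" and "0 < \<delta>" "0 < \<eta>"
  shows "\<exists>\<rho>>0. \<forall>y. norm y < \<rho> \<longrightarrow> emeasure M {\<omega>\<in>K. \<delta> < norm (\<iota> y \<omega>)} \<le> ennreal \<eta>"
proof -
  define N where "N = density M (\<lambda>\<omega>. ennreal (\<beta> \<omega>))"
  have [measurable]: "\<iota> x \<in> borel_measurable M" for x
    using L0 by (auto simp: normed_L0_subspace_def)
  have [simp]: "sets N = sets M" "space N = space M" by (auto simp: N_def)
  have [measurable]: "\<iota> x \<in> borel_measurable N" for x by (simp add: N_def)
  have "AE \<omega> in M. \<iota> (0 *\<^sub>R 0) \<omega> = 0 *\<^sub>R \<iota> 0 \<omega>"
    using L0 unfolding normed_L0_subspace_def by blast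
  then have zero: "AE \<omega> in N. \<iota> 0 \<omega> = 0"
    unfolding N_def using \<beta> by (subst AE_density) auto
  obtain \<theta> where \<theta>: "0 < \<theta>" "\<And>A. A \<in> sets M \<Longrightarrow> emeasure N A \<le> ennreal \<theta> \<Longrightarrow> emeasure M (K \<inter> A) \<le> ennreal \<eta>"
    using emeasure_density_positive_absolutely_continuous[OF \<beta> pos K \<open>0 < \<eta>\<close>] unfolding N_def by auto
  obtain t where t: "0 < t" "\<And>x :: 'w \<Rightarrow> 'e. x \<in> Lp_space p N \<Longrightarrow> Lp_norm p N x < t \<Longrightarrow>
      emeasure N {\<omega>\<in>space N. \<delta> < norm (x \<omega>)} \<le> ennreal \<theta>"
    using Lp_norm_small_imp_small_in_measure[OF p \<open>0 < \<delta>\<close> \<theta>(1), of N] by auto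
  have cong: "Lp_norm p N (\<lambda>\<omega>. \<iota> y \<omega> - \<iota> 0 \<omega>) = Lp_norm p N (\<iota> y)" for y
    using zero by (intro Lp_norm_cong_AE) auto
  have "((\<lambda>y. Lp_norm p N (\<lambda>\<omega>. \<iota> y \<omega> - \<iota> 0 \<omega>)) \<longlongrightarrow> 0) (at 0)"
    using incl unfolding continuously_included_in_Lp_def N_def by blast
  then have "eventually (\<lambda>y. Lp_norm p N (\<iota> y) < t) (at 0)"
    unfolding cong using t(1) by (intro order_tendstoD(2)) auto
  then obtain \<rho> where \<rho>: "0 < \<rho>" "\<And>y. y \<noteq> 0 \<Longrightarrow> norm y < \<rho> \<Longrightarrow> Lp_norm p N (\<iota> y) < t"
    by (auto simp: eventually_at dist_norm)
  have "Lp_norm p N (\<iota> 0) = Lp_norm p N (\<lambda>\<omega>. 0 :: 'e)"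
    using zero by (intro Lp_norm_cong_AE) auto
  also have "\<dots> = 0"
  proof -
    have "esssup N (\<lambda>\<omega>. 0 :: ennreal) \<le> 0" by (intro esssup_I) auto
    then show ?thesis by (simp add: Lp_norm_def)
  qed
  finally have "Lp_norm p N (\<iota> y) < t" if "norm y < \<rho>" for y
    using \<rho>(2)[of y] t(1) that by (cases "y = 0") auto
  moreover have "\<iota> y \<in> Lp_space p N" for y
    using incl unfolding continuously_included_in_Lp_def N_def by blast
  ultimately have "emeasure M (K \<inter> {\<omega>\<in>space M. \<delta> < norm (\<iota> y \<omega>)}) \<le> ennreal \<eta>" if "norm y < \<rho>" for y
    using \<theta>(2)[of "{\<omega>\<in>space M. \<delta> < norm (\<iota> y \<omega>)}"] t(2)[of "\<iota> y"] that by auto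
  moreover have "K \<inter> {\<omega>\<in>space M. \<delta> < norm (\<iota> y \<omega>)} = {\<omega>\<in>K. \<delta> < norm (\<iota> y \<omega>)}" for y
    using sets.sets_into_space[OF K(1)] by auto
  ultimately show ?thesis using \<rho>(1) by auto
qed

section \<open>Frechet subderivatives of extended real functions\<close>

lemma le_ereal_divide_pos_iff:
  assumes "0 < (n::real)"
  shows "ereal c \<le> D / ereal n \<longleftrightarrow> ereal (c * n) \<le> D"
  using assms by (cases D) (auto simp: field_simps)

text \<open>Multiplying out the quotient turns the lower limit into a growth condition. The filter \<open>at y0\<close> does
  not see \<open>z = 0\<close>, but the condition holds there because \<open>J y0\<close> is finite and \<open>l 0 = 0\<close>.\<close>

lemma frechet_subderivative_iff:
  "frechet_subderivative J y0 l \<longleftrightarrow> \<bar>J y0\<bar> \<noteq> \<infinity> \<and> bounded_linear l \<and>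
    (\<forall>\<epsilon>>0. \<exists>\<delta>>0. \<forall>z. norm z < \<delta> \<longrightarrow> ereal (- \<epsilon> * norm z) \<le> J (y0 + z) - J y0 - ereal (l z))"
  (is "_ \<longleftrightarrow> _ \<and> _ \<and> ?growth")
proof -
  have key: "0 \<le> Liminf (at y0) (\<lambda>y. (J y - J y0 - ereal (l (y - y0))) / ereal (norm (y - y0))) \<longleftrightarrow> ?growth"
    (is "0 \<le> Liminf _ ?Q \<longleftrightarrow> _")
    if fin: "\<bar>J y0\<bar> \<noteq> \<infinity>" and l: "bounded_linear l"
  proof
    assume "0 \<le> Liminf (at y0) ?Q"
    then have ev: "eventually (\<lambda>y. c < ?Q y) (at y0)" if "c < 0" for c
      using that unfolding le_Liminf_iff by blast
    show ?growth
    proof (intro allI impI)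
      fix \<epsilon> :: real assume "0 < \<epsilon>"
      then have "eventually (\<lambda>y. ereal (- \<epsilon>) < ?Q y) (at y0)" by (intro ev) auto
      then obtain \<delta> where \<delta>: "0 < \<delta>" "\<And>y. y \<noteq> y0 \<Longrightarrow> dist y y0 < \<delta> \<Longrightarrow> ereal (- \<epsilon>) < ?Q y"
        by (auto simp: eventually_at)
      have "ereal (- \<epsilon> * norm z) \<le> J (y0 + z) - J y0 - ereal (l z)" if "norm z < \<delta>" for z
      proof (cases "z = 0")
        case True
        then show ?thesis using fin linear_0[OF bounded_linear.linear[OF l]]
          by (cases "J y0") auto
      next
        case False
        then have "ereal (- \<epsilon>) \<le> ?Q (y0 + z)"
          using that by (intro less_imp_le \<delta>(2)) (auto simp: dist_norm)
        then show ?thesis using False le_ereal_divide_pos_iff[of "norm z" "- \<epsilon>"] by simp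
      qed
      then show "\<exists>\<delta>>0. \<forall>z. norm z < \<delta> \<longrightarrow> ereal (- \<epsilon> * norm z) \<le> J (y0 + z) - J y0 - ereal (l z)"
        using \<delta>(1) by blast
    qed
  next
    assume growth: ?growth
    show "0 \<le> Liminf (at y0) ?Q"
      unfolding le_Liminf_iff
    proof (intro allI impI)
      fix c :: ereal assume "c < 0"
      then obtain b where b: "c < ereal b" "ereal b < 0"
        using ereal_dense2[of c 0] by auto
      then have "0 < - b" by simp
      with growth obtain \<delta> where \<delta>: "0 < \<delta>"
          "\<And>z. norm z < \<delta> \<Longrightarrow> ereal (b * norm z) \<le> J (y0 + z) - J y0 - ereal (l z)"
        by (metis minus_minus)
      have "c < ?Q y" if "y \<noteq> y0" "dist y y0 < \<delta>" for y
      proof -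
        have "ereal (b * norm (y - y0)) \<le> J y - J y0 - ereal (l (y - y0))"
          using \<delta>(2)[of "y - y0"] that by (auto simp: dist_norm)
        then have "ereal b \<le> ?Q y"
          using that by (subst le_ereal_divide_pos_iff) auto
        then show ?thesis using b(1) by order
      qed
      then show "eventually (\<lambda>y. c < ?Q y) (at y0)"
        using \<delta>(1) unfolding eventually_at by blast
    qed
  qed
  show ?thesis unfolding frechet_subderivative_def by (intro conj_cong refl key)
qed

text \<open>The pointwise form of the growth condition along a sequence of steps that tends to \<open>0\<close>; the
  directions \<open>b n\<close> themselves may be unbounded, which is why their norms stay on the right.\<close>

lemma negative_part_difference_quotient_eventually_le:
  fixes b :: "nat \<Rightarrow> 'y::real_normed_vector"
  assumes F: "frechet_subderivative F e0 l" and r: "\<And>n. 0 < r n"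
    and lim: "(\<lambda>n. r n *\<^sub>R b n) \<longlonglongrightarrow> 0" and "0 < \<delta>"
  shows "\<forall>\<^sub>F n in sequentially. negative_part (ereal (inverse (r n)) *
    ((F (e0 + r n *\<^sub>R b n) - ereal (l (e0 + r n *\<^sub>R b n))) - (F e0 - ereal (l e0)))) \<le> ereal (\<delta> * norm (b n))"
proof -
  have fin: "\<bar>F e0\<bar> \<noteq> \<infinity>" and l: "bounded_linear l"
    using F by (auto simp: frechet_subderivative_def)
  obtain \<theta> where \<theta>: "0 < \<theta>"
      "\<And>z. norm z < \<theta> \<Longrightarrow> ereal (- \<delta> * norm z) \<le> F (e0 + z) - F e0 - ereal (l z)"
    using F \<open>0 < \<delta>\<close> unfolding frechet_subderivative_iff by blast
  have "eventually (\<lambda>n. norm (r n *\<^sub>R b n) < \<theta>) sequentially"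
    using tendsto_norm_zero[OF lim] \<theta>(1) by (rule order_tendstoD(2))
  then show ?thesis
  proof eventually_elim
    case (elim n)
    have *: "ereal (- \<delta> * norm (r n *\<^sub>R b n)) \<le> F (e0 + r n *\<^sub>R b n) - F e0 - ereal (l (r n *\<^sub>R b n))"
      by (rule \<theta>(2)[OF elim])
    have add: "l (e0 + r n *\<^sub>R b n) = l e0 + l (r n *\<^sub>R b n)"
      using linear_add[OF bounded_linear.linear[OF l]] .
    have nonneg: "0 \<le> \<delta> * norm (b n)" using \<open>0 < \<delta>\<close> by simp
    obtain a where a: "F e0 = ereal a" using fin by auto
    show ?case
    proof (cases "F (e0 + r n *\<^sub>R b n)")
      case (real c)
      then have "- \<delta> * (r n * norm (b n)) \<le> c - a - l (r n *\<^sub>R b n)"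
        using * a r[of n] by simp
      then have "- (inverse (r n) * (c - a - l (r n *\<^sub>R b n))) \<le> \<delta> * norm (b n)"
        using r[of n] by (simp add: field_simps)
      then show ?thesis
        using real a nonneg by (simp add: add negative_part_def algebra_simps)
    next
      case PInf
      then show ?thesis using a r[of n] nonneg by (simp add: negative_part_def)
    next
      case MInf
      then show ?thesis using * a by simp
    qed
  qed
qed

section \<open>The increment of the integral functional\<close>

locale integral_functional_on_decomposable_space =
  fixes M :: "'w measure"
    and \<iota> :: "'x::real_normed_vector \<Rightarrow> 'w \<Rightarrow> 'e::{banach, second_countable_topology}"
    and p :: ennreal
    and \<beta> :: "'w \<Rightarrow> real"
    and f :: "'w \<Rightarrow> 'e \<Rightarrow> ereal"
    and x0 :: 'x
    and xs :: "'w \<Rightarrow> 'e \<Rightarrow>\<^sub>L real"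
  assumes sigma_finite: "sigma_finite_measure M"
    and L0: "normed_L0_subspace M \<iota>"
    and decomposable: "decomposable M \<iota>"
    and p: "1 \<le> p"
    and weight_measurable: "\<beta> \<in> borel_measurable M"
    and weight_pos: "\<forall>\<omega>\<in>space M. 0 < \<beta> \<omega>"
    and inclusion: "continuously_included_in_Lp \<iota> p (density M (\<lambda>\<omega>. ennreal (\<beta> \<omega>)))"
    and solid: "solid_frechet_bornology M \<iota>"
    and integrand: "measurable_integrand M f"
    and finite_at_x0: "\<bar>integral_functional M f (\<iota> x0)\<bar> \<noteq> \<infinity>"
    and dual: "in_dual_L0 M \<iota> xs"
begin

abbreviation g :: "'w \<Rightarrow> 'e \<Rightarrow> ereal" where
  "g \<omega> e \<equiv> f \<omega> e - ereal (blinfun_apply (xs \<omega>) e)"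

definition increment :: "'x \<Rightarrow> ereal" where
  "increment z = upper_integral M (\<lambda>\<omega>. g \<omega> (\<iota> x0 \<omega> + \<iota> z \<omega>) - g \<omega> (\<iota> x0 \<omega>))"

abbreviation quotient :: "real \<Rightarrow> 'x \<Rightarrow> 'w \<Rightarrow> ereal" where
  "quotient r x \<equiv> difference_quotient g (\<iota> x0) r (\<iota> x)"

lemma measurable_representative[measurable]: "\<iota> x \<in> borel_measurable M"
  using L0 by (auto simp: normed_L0_subspace_def)

lemma representative_add: "AE \<omega> in M. \<iota> (x + y) \<omega> = \<iota> x \<omega> + \<iota> y \<omega>"
  using L0 by (auto simp: normed_L0_subspace_def)

lemma representative_scaleR: "AE \<omega> in M. \<iota> (c *\<^sub>R x) \<omega> = c *\<^sub>R \<iota> x \<omega>"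
  using L0 by (auto simp: normed_L0_subspace_def)

lemma representative_zero: "AE \<omega> in M. \<iota> 0 \<omega> = 0"
  using representative_scaleR[of 0 0] by simp

lemma integrable_pairing: "integrable M (\<lambda>\<omega>. blinfun_apply (xs \<omega>) (\<iota> x \<omega>))"
  using dual by (auto simp: in_dual_L0_def)

lemma measurable_pairing[measurable]: "(\<lambda>\<omega>. blinfun_apply (xs \<omega>) (\<iota> x \<omega>)) \<in> borel_measurable M"
  using integrable_pairing by auto

lemma measurable_integrand_comp:
  assumes [measurable]: "x \<in> borel_measurable M"
  shows "(\<lambda>\<omega>. f \<omega> (x \<omega>)) \<in> borel_measurable M"
proof -
  have "(\<lambda>\<omega>. (\<omega>, x \<omega>)) \<in> M \<rightarrow>\<^sub>M M \<Otimes>\<^sub>M borel" by measurable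
  from measurable_compose[OF this integrand[unfolded measurable_integrand_def]] show ?thesis by simp
qed

lemma measurable_quotient[measurable]: "quotient r x \<in> borel_measurable M"
proof -
  have [measurable]: "(\<lambda>\<omega>. f \<omega> (\<iota> x0 \<omega> + r *\<^sub>R \<iota> x \<omega>)) \<in> borel_measurable M"
      "(\<lambda>\<omega>. f \<omega> (\<iota> x0 \<omega>)) \<in> borel_measurable M"
    by (intro measurable_integrand_comp; measurable)+
  show ?thesis
    unfolding difference_quotient_def blinfun.add_right blinfun.scaleR_right by measurable
qed

lemma integrand_finite_at_x0:
  obtains \<phi> where "integrable M \<phi>" "AE \<omega> in M. f \<omega> (\<iota> x0 \<omega>) = ereal (\<phi> \<omega>)"
proof (rule integrable_if_finite_upper_integral[OF sigma_finite])
  show "(\<lambda>\<omega>. f \<omega> (\<iota> x0 \<omega>)) \<in> borel_measurable M" by (intro measurable_integrand_comp) measurable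
  show "\<bar>upper_integral M (\<lambda>\<omega>. f \<omega> (\<iota> x0 \<omega>))\<bar> \<noteq> \<infinity>"
    using finite_at_x0 by (simp add: integral_functional_def)
qed

text \<open>Finiteness of \<open>I\<^sub>f(x\<^sub>0)\<close> makes \<open>f(\<cdot>, x\<^sub>0)\<close> almost everywhere equal to an integrable \<open>\<phi>\<close>, so
  \<open>-\<phi> - \<langle>x\<^sup>*, z\<rangle>\<close> can be moved under the upper integral of \<open>f(\<cdot>, x\<^sub>0 + z)\<close>.\<close>

lemma increment_eq:
  "integral_functional M f (\<iota> (x0 + z)) - integral_functional M f (\<iota> x0) - ereal (integral_pairing M \<iota> xs z)
    = increment z"
proof -
  obtain \<phi> where \<phi>: "integrable M \<phi>" and f0: "AE \<omega> in M. f \<omega> (\<iota> x0 \<omega>) = ereal (\<phi> \<omega>)"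
    using integrand_finite_at_x0 .
  have J0: "integral_functional M f (\<iota> x0) = ereal (integral\<^sup>L M \<phi>)"
    unfolding integral_functional_def using upper_integral_cong_AE[OF f0] upper_integral_ereal[OF \<phi>] by simp
  have int: "integrable M (\<lambda>\<omega>. - \<phi> \<omega> - blinfun_apply (xs \<omega>) (\<iota> z \<omega>))"
    using \<phi> integrable_pairing by auto
  have "increment z = upper_integral M (\<lambda>\<omega>. f \<omega> (\<iota> (x0 + z) \<omega>) + ereal (- \<phi> \<omega> - blinfun_apply (xs \<omega>) (\<iota> z \<omega>)))"
    unfolding increment_def
  proof (rule upper_integral_cong_AE)
    show "AE \<omega> in M. g \<omega> (\<iota> x0 \<omega> + \<iota> z \<omega>) - g \<omega> (\<iota> x0 \<omega>)
        = f \<omega> (\<iota> (x0 + z) \<omega>) + ereal (- \<phi> \<omega> - blinfun_apply (xs \<omega>) (\<iota> z \<omega>))"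
      using f0 representative_add[of x0 z]
    proof eventually_elim
      case (elim \<omega>)
      then show ?case
        by (cases "f \<omega> (\<iota> x0 \<omega> + \<iota> z \<omega>)") (auto simp: blinfun.add_right)
    qed
  qed
  also have "\<dots> = integral_functional M f (\<iota> (x0 + z))
      + ereal (integral\<^sup>L M (\<lambda>\<omega>. - \<phi> \<omega> - blinfun_apply (xs \<omega>) (\<iota> z \<omega>)))"
    unfolding integral_functional_def by (rule upper_integral_add_integrable[OF int])
  also have "integral\<^sup>L M (\<lambda>\<omega>. - \<phi> \<omega> - blinfun_apply (xs \<omega>) (\<iota> z \<omega>))
      = - integral\<^sup>L M \<phi> - integral_pairing M \<iota> xs z"
    unfolding integral_pairing_def using \<phi> integrable_pairing by simp
  finally show ?thesis
    unfolding J0 by (cases "integral_functional M f (\<iota> (x0 + z))") auto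
qed

lemma frechet_subderivative_iff_increment:
  "frechet_subderivative (\<lambda>x. integral_functional M f (\<iota> x)) x0 (integral_pairing M \<iota> xs) \<longleftrightarrow>
    (\<forall>\<epsilon>>0. \<exists>\<delta>>0. \<forall>z. norm z < \<delta> \<longrightarrow> ereal (- \<epsilon> * norm z) \<le> increment z)"
  using finite_at_x0 dual by (simp add: frechet_subderivative_iff increment_eq in_dual_L0_def)

lemma increment_scaleR:
  assumes "0 < r"
  shows "increment (r *\<^sub>R x) = upper_integral M (\<lambda>\<omega>. ereal r * quotient r x \<omega>)"
  unfolding increment_def
proof (rule upper_integral_cong_AE)
  have cancel: "ereal r * (ereal (inverse r) * a) = a" for a
    using assms by (simp add: mult.assoc[symmetric])
  show "AE \<omega> in M. g \<omega> (\<iota> x0 \<omega> + \<iota> (r *\<^sub>R x) \<omega>) - g \<omega> (\<iota> x0 \<omega>) = ereal r * quotient r x \<omega>"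
    using representative_scaleR[of r x]
    by eventually_elim (simp only: difference_quotient_def cancel)
qed

lemma increment_zero: "increment 0 = 0"
proof -
  obtain \<phi> where "AE \<omega> in M. f \<omega> (\<iota> x0 \<omega>) = ereal (\<phi> \<omega>)"
    using integrand_finite_at_x0 .
  then have "AE \<omega> in M. g \<omega> (\<iota> x0 \<omega> + \<iota> 0 \<omega>) - g \<omega> (\<iota> x0 \<omega>) = ereal 0"
    using representative_zero by eventually_elim auto
  then have "increment 0 = upper_integral M (\<lambda>\<omega>. ereal 0)"
    unfolding increment_def by (rule upper_integral_cong_AE)
  then show ?thesis using upper_integral_ereal[of M "\<lambda>_. 0"] by (simp add: zero_ereal_def)
qed

section \<open>From the subderivative to lower compactness\<close>

text \<open>Decomposability with \<open>0\<close> as the second function.\<close>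

lemma restriction_exists:
  assumes "A \<in> sets M"
  obtains z where "AE \<omega> in M. \<iota> z \<omega> = indicat_real A \<omega> *\<^sub>R \<iota> x \<omega>"
proof -
  obtain z where "AE \<omega> in M. \<iota> z \<omega> = indicat_real A \<omega> *\<^sub>R \<iota> x \<omega> + indicat_real (space M - A) \<omega> *\<^sub>R \<iota> 0 \<omega>"
    using decomposable assms unfolding decomposable_def by blast
  then have "AE \<omega> in M. \<iota> z \<omega> = indicat_real A \<omega> *\<^sub>R \<iota> x \<omega>"
    using representative_zero by eventually_elim auto
  then show thesis by (rule that)
qed

text \<open>Off the negative set the direction is \<open>0\<close> and the integrand of the increment vanishes, so only the
  negative part of the quotient in the original direction remains.\<close>

lemma increment_restriction_to_negative_set:
  assumes "0 < r"
    and z: "AE \<omega> in M. \<iota> z \<omega> = indicat_real {\<omega>\<in>space M. quotient r x \<omega> < 0} \<omega> *\<^sub>R \<iota> x \<omega>"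
  shows "increment (r *\<^sub>R z) = upper_integral M (\<lambda>\<omega>. - (ereal r * negative_part (quotient r x \<omega>)))"
  unfolding increment_scaleR[OF \<open>0 < r\<close>]
proof (rule upper_integral_cong_AE)
  obtain \<phi> where "AE \<omega> in M. f \<omega> (\<iota> x0 \<omega>) = ereal (\<phi> \<omega>)"
    using integrand_finite_at_x0 .
  then show "AE \<omega> in M. ereal r * quotient r z \<omega> = - (ereal r * negative_part (quotient r x \<omega>))"
    using z AE_space
  proof eventually_elim
    case (elim \<omega>)
    show ?case
    proof (cases "quotient r x \<omega> < 0")
      case True
      with elim have "quotient r z \<omega> = quotient r x \<omega>" by (simp add: difference_quotient_def)
      moreover have "negative_part (quotient r x \<omega>) = - quotient r x \<omega>"
        using True by (simp add: negative_part_def max_def less_imp_le)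
      ultimately show ?thesis by simp
    next
      case False
      with elim have "\<iota> z \<omega> = 0" by simp
      with elim have "quotient r z \<omega> = 0" by (simp add: difference_quotient_def zero_ereal_def)
      moreover have "negative_part (quotient r x \<omega>) = 0"
        using False by (simp add: negative_part_def max_def not_less)
      ultimately show ?thesis by simp
    qed
  qed
qed

text \<open>The upper integral of a nonpositive function determines its \<open>L\<^sub>1\<close> norm, so a lower bound for the increment in the
  restricted direction controls the negative part of the quotient in the original one.\<close>

lemma negative_part_L1_bound:
  assumes "0 < r" "0 \<le> c" and ge: "ereal (- (r * c)) \<le> increment (r *\<^sub>R z)"
    and z: "AE \<omega> in M. \<iota> z \<omega> = indicat_real {\<omega>\<in>space M. quotient r x \<omega> < 0} \<omega> *\<^sub>R \<iota> x \<omega>"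
  shows "AE \<omega> in M. negative_part (quotient r x \<omega>) \<noteq> \<infinity>"
    and "(\<integral>\<^sup>+ \<omega>. ennreal \<bar>real_of_ereal (negative_part (quotient r x \<omega>))\<bar> \<partial>M) \<le> ennreal c"
proof -
  have [measurable]: "(\<lambda>\<omega>. negative_part (quotient r x \<omega>)) \<in> borel_measurable M"
    unfolding negative_part_def by measurable
  have nonneg: "0 \<le> negative_part a" for a by (simp add: negative_part_def)
  have "(\<integral>\<^sup>+ \<omega>. e2ennreal (- (- (ereal r * negative_part (quotient r x \<omega>)))) \<partial>M) \<le> ennreal (r * c)"
  proof (rule nn_integral_uminus_le_if_upper_integral_ge[OF sigma_finite])
    show "AE \<omega> in M. - (ereal r * negative_part (quotient r x \<omega>)) \<le> 0"
      using \<open>0 < r\<close> nonneg by simp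
    show "ereal (- (r * c)) \<le> upper_integral M (\<lambda>\<omega>. - (ereal r * negative_part (quotient r x \<omega>)))"
      using ge increment_restriction_to_negative_set[OF \<open>0 < r\<close> z] by simp
  qed measurable
  then have le: "(\<integral>\<^sup>+ \<omega>. e2ennreal (ereal r * negative_part (quotient r x \<omega>)) \<partial>M) \<le> ennreal (r * c)"
    by simp
  also have "\<dots> < \<infinity>" by simp
  finally have "AE \<omega> in M. e2ennreal (ereal r * negative_part (quotient r x \<omega>)) \<noteq> \<infinity>"
    by (intro nn_integral_PInf_AE) auto
  then show fin: "AE \<omega> in M. negative_part (quotient r x \<omega>) \<noteq> \<infinity>"
    by eventually_elim (use \<open>0 < r\<close> in auto)
  have "AE \<omega> in M. ennreal \<bar>real_of_ereal (negative_part (quotient r x \<omega>))\<bar>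
      = ennreal (1 / r) * e2ennreal (ereal r * negative_part (quotient r x \<omega>))"
    using fin
  proof eventually_elim
    case (elim \<omega>)
    then obtain a where a: "negative_part (quotient r x \<omega>) = ereal a" "0 \<le> a"
      using nonneg[of "quotient r x \<omega>"] by (cases "negative_part (quotient r x \<omega>)") auto
    then show ?case using \<open>0 < r\<close> by (simp add: ennreal_mult[symmetric])
  qed
  then have "(\<integral>\<^sup>+ \<omega>. ennreal \<bar>real_of_ereal (negative_part (quotient r x \<omega>))\<bar> \<partial>M)
      = (\<integral>\<^sup>+ \<omega>. ennreal (1 / r) * e2ennreal (ereal r * negative_part (quotient r x \<omega>)) \<partial>M)"
    by (rule nn_integral_cong_AE)
  also have "\<dots> = ennreal (1 / r) * (\<integral>\<^sup>+ \<omega>. e2ennreal (ereal r * negative_part (quotient r x \<omega>)) \<partial>M)"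
    by (rule nn_integral_cmult) measurable
  also have "\<dots> \<le> ennreal (1 / r) * ennreal (r * c)"
    by (intro mult_left_mono le) simp
  also have "\<dots> = ennreal c"
    using \<open>0 < r\<close> \<open>0 \<le> c\<close> by (simp add: ennreal_mult[symmetric])
  finally show "(\<integral>\<^sup>+ \<omega>. ennreal \<bar>real_of_ereal (negative_part (quotient r x \<omega>))\<bar> \<partial>M) \<le> ennreal c" .
qed

lemma lower_compactness_if_frechet_subderivative:
  assumes "frechet_subderivative (\<lambda>x. integral_functional M f (\<iota> x)) x0 (integral_pairing M \<iota> xs)"
  shows "frechet_lower_compactness M \<iota> g x0"
  unfolding frechet_lower_compactness_def
proof (intro allI impI)
  fix r :: "nat \<Rightarrow> real" and x :: "nat \<Rightarrow> 'x"
  assume r: "\<forall>n. 0 < r n" "r \<longlonglongrightarrow> 0" and x: "bounded (range x)"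
  define u where "u n \<omega> = real_of_ereal (negative_part (quotient (r n) (x n) \<omega>))" for n \<omega>
  define B where "B n = {\<omega>\<in>space M. quotient (r n) (x n) \<omega> < 0}" for n
  have B: "B n \<in> sets M" for n unfolding B_def by measurable
  have "\<exists>z. AE \<omega> in M. \<iota> z \<omega> = indicat_real (B n) \<omega> *\<^sub>R \<iota> (x n) \<omega>" for n
    using restriction_exists[OF B[of n], of "x n"] by blast
  then obtain z where z: "\<And>n. AE \<omega> in M. \<iota> (z n) \<omega> = indicat_real (B n) \<omega> *\<^sub>R \<iota> (x n) \<omega>"
    by metis
  have "bounded {z. \<exists>x'\<in>range x. \<exists>A\<in>sets M. AE \<omega> in M. \<iota> z \<omega> = indicat_real A \<omega> *\<^sub>R \<iota> x' \<omega>}"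
    using solid x unfolding solid_frechet_bornology_def by blast
  then obtain C where C: "0 < C" "\<And>n. norm (z n) \<le> C"
    unfolding bounded_pos using z B by blast
  have bound: "\<forall>\<^sub>F n in sequentially. (AE \<omega> in M. negative_part (quotient (r n) (x n) \<omega>) \<noteq> \<infinity>) \<and>
      (\<integral>\<^sup>+ \<omega>. ennreal \<bar>u n \<omega>\<bar> \<partial>M) \<le> ennreal \<epsilon>" if "0 < \<epsilon>" for \<epsilon>
  proof -
    \<comment> \<open>The steps \<open>r n *\<^sub>R z n\<close> have norm at most \<open>r n * C\<close>, so growth constant \<open>\<epsilon> / C\<close> yields the bound \<open>\<epsilon>\<close>.\<close>
    have "0 < \<epsilon> / C" using that C(1) by simp
    then obtain \<delta> where \<delta>: "0 < \<delta>" "\<And>y. norm y < \<delta> \<Longrightarrow> ereal (- (\<epsilon> / C) * norm y) \<le> increment y"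
      using assms unfolding frechet_subderivative_iff_increment by blast
    have "eventually (\<lambda>n. r n < \<delta> / C) sequentially"
      using r(2) \<delta>(1) C(1) by (intro order_tendstoD(2)) auto
    then show ?thesis
    proof eventually_elim
      case (elim n)
      have rn: "0 < r n" using r by simp
      have "norm (r n *\<^sub>R z n) \<le> r n * C" using C rn by simp
      also have "\<dots> < \<delta>" using elim C(1) by (simp add: field_simps)
      finally have "ereal (- (\<epsilon> / C) * norm (r n *\<^sub>R z n)) \<le> increment (r n *\<^sub>R z n)" by (rule \<delta>(2))
      moreover have "(\<epsilon> / C) * norm (r n *\<^sub>R z n) \<le> (\<epsilon> / C) * (r n * C)"
        using C rn that by (intro mult_left_mono) auto
      ultimately have "ereal (- (r n * \<epsilon>)) \<le> increment (r n *\<^sub>R z n)"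
        using C(1) by (elim order_trans[rotated]) (simp add: field_simps)
      from negative_part_L1_bound[OF rn _ this z[unfolded B_def]] that
      show ?case unfolding u_def by simp
    qed
  qed
  from bound[of 1] obtain n0 where n0: "\<And>n. n \<ge> n0 \<Longrightarrow> AE \<omega> in M. negative_part (quotient (r n) (x n) \<omega>) \<noteq> \<infinity>"
      "\<And>n. n \<ge> n0 \<Longrightarrow> (\<integral>\<^sup>+ \<omega>. ennreal \<bar>u n \<omega>\<bar> \<partial>M) \<le> ennreal 1"
    by (auto simp: eventually_sequentially)
  have "uniformly_integrable M (u ` {n0..})"
  proof (rule uniformly_integrable_if_L1_null[OF sigma_finite])
    fix n assume "n \<ge> n0"
    have "(\<integral>\<^sup>+ \<omega>. ennreal (norm (u n \<omega>)) \<partial>M) < \<infinity>"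
      using le_less_trans[OF n0(2)[OF \<open>n \<ge> n0\<close>] ennreal_less_top] by simp
    moreover have "u n \<in> borel_measurable M" unfolding u_def negative_part_def by measurable
    ultimately show "integrable M (u n)" by (intro integrableI_bounded)
  next
    fix \<epsilon> :: real assume "0 < \<epsilon>"
    from bound[OF this] show "\<forall>\<^sub>F n in sequentially. (\<integral>\<^sup>+ \<omega>. ennreal \<bar>u n \<omega>\<bar> \<partial>M) \<le> ennreal \<epsilon>"
      by eventually_elim simp
  qed
  then show "\<exists>n0. (\<forall>n\<ge>n0. AE \<omega> in M. negative_part (quotient (r n) (x n) \<omega>) \<noteq> \<infinity>) \<and>
      uniformly_integrable M ((\<lambda>n \<omega>. real_of_ereal (negative_part (quotient (r n) (x n) \<omega>))) ` {n0..})"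
    using n0(1) unfolding u_def by blast
qed

section \<open>From lower compactness to the subderivative\<close>

lemma small_in_measure:
  assumes "K \<in> sets M" "emeasure M K < \<infinity>" "0 < \<delta>" "0 < \<eta>"
  shows "\<exists>\<rho>>0. \<forall>y. norm y < \<rho> \<longrightarrow> emeasure M {\<omega>\<in>K. \<delta> < norm (\<iota> y \<omega>)} \<le> ennreal \<eta>"
  by (rule small_norm_imp_locally_small_in_measure[OF L0 p weight_measurable weight_pos inclusion assms])

text \<open>By homogeneity: shrinking \<open>x\<close> by the factor \<open>\<rho> / 2\<close> makes its norm smaller than \<open>\<rho>\<close>.\<close>

lemma unit_ball_locally_bounded_in_measure:
  assumes K: "K \<in> sets M" "emeasure M K < \<infinity>" and "0 < \<eta>"
  obtains R where "0 < R" "\<And>x. norm x \<le> 1 \<Longrightarrow> emeasure M {\<omega>\<in>K. R < norm (\<iota> x \<omega>)} \<le> ennreal \<eta>"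
proof -
  obtain \<rho> where \<rho>: "0 < \<rho>"
      "\<And>y. norm y < \<rho> \<Longrightarrow> emeasure M {\<omega>\<in>K. 1 < norm (\<iota> y \<omega>)} \<le> ennreal \<eta>"
    using small_in_measure[OF K, of 1 \<eta>] \<open>0 < \<eta>\<close> by auto
  show thesis
  proof (rule that[of "2 / \<rho>"])
    show "0 < 2 / \<rho>" using \<rho>(1) by simp
    fix x :: 'x assume "norm x \<le> 1"
    then have small: "norm ((\<rho> / 2) *\<^sub>R x) < \<rho>"
      using \<rho>(1) mult_left_mono[of "norm x" 1 "\<rho> / 2"] by simp
    have "emeasure M {\<omega>\<in>K. 2 / \<rho> < norm (\<iota> x \<omega>)} \<le> emeasure M {\<omega>\<in>K. 1 < norm (\<iota> ((\<rho> / 2) *\<^sub>R x) \<omega>)}"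
    proof (rule emeasure_mono_AE)
      show "AE \<omega> in M. \<omega> \<in> {\<omega>\<in>K. 2 / \<rho> < norm (\<iota> x \<omega>)} \<longrightarrow> \<omega> \<in> {\<omega>\<in>K. 1 < norm (\<iota> ((\<rho> / 2) *\<^sub>R x) \<omega>)}"
        using representative_scaleR[of "\<rho> / 2" x]
        by eventually_elim (use \<rho>(1) in \<open>auto simp: field_simps\<close>)
    qed (intro sets_superlevel_in_subset K; measurable)
    also have "\<dots> \<le> ennreal \<eta>" by (rule \<rho>(2)[OF small])
    finally show "emeasure M {\<omega>\<in>K. 2 / \<rho> < norm (\<iota> x \<omega>)} \<le> ennreal \<eta>" .
  qed
qed

text \<open>Where \<open>\<parallel>\<iota> (x n) \<omega>\<parallel> \<le> R\<close>, the growth condition with constant \<open>\<delta> / R\<close> eventually keeps the negative part below \<open>\<delta>\<close>, and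
  \<open>R\<close> can be chosen so large that the remaining points of \<open>K\<close> have measure at most \<open>\<eta> / 2\<close> for
  every \<open>n\<close>.\<close>

lemma negative_parts_locally_null_in_measure:
  assumes along: "frechet_subderivative_along M f (\<iota> x0) xs"
    and r: "\<And>n. 0 < r n" and x: "\<And>n. norm (x n) \<le> 1"
    and lim: "AE \<omega> in M. (\<lambda>n. r n *\<^sub>R \<iota> (x n) \<omega>) \<longlonglongrightarrow> 0"
    and K: "K \<in> sets M" "emeasure M K < \<infinity>" and "0 < \<delta>" "0 < \<eta>"
  shows "\<forall>\<^sub>F n in sequentially.
    emeasure M {\<omega>\<in>K. \<delta> < \<bar>real_of_ereal (negative_part (quotient (r n) (x n) \<omega>))\<bar>} \<le> ennreal \<eta>"
proof -
  note [measurable] = K(1)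
  define u where "u n \<omega> = real_of_ereal (negative_part (quotient (r n) (x n) \<omega>))" for n \<omega>
  have [measurable]: "u n \<in> borel_measurable M" for n
    unfolding u_def negative_part_def by measurable
  have "0 < \<eta> / 2" using \<open>0 < \<eta>\<close> by simp
  then obtain R where R: "0 < R"
      "\<And>y. norm y \<le> 1 \<Longrightarrow> emeasure M {\<omega>\<in>K. R < norm (\<iota> y \<omega>)} \<le> ennreal (\<eta> / 2)"
    using unit_ball_locally_bounded_in_measure[OF K] by blast
  define B where "B n = {\<omega>\<in>space M. \<omega> \<in> K \<and> \<delta> < \<bar>u n \<omega>\<bar> \<and> norm (\<iota> (x n) \<omega>) \<le> R}" for n
  have [measurable]: "B n \<in> sets M" for n unfolding B_def by measurable
  have "(\<lambda>n. \<integral>\<^sup>+ \<omega>. indicator (B n) \<omega> \<partial>M) \<longlonglongrightarrow> (\<integral>\<^sup>+ \<omega>. 0 \<partial>M)"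
  proof (rule nn_integral_dominated_convergence)
    show "AE \<omega> in M. indicator (B n) \<omega> \<le> (indicator K \<omega> :: ennreal)" for n
      by (auto simp: B_def indicator_def)
    show "(\<integral>\<^sup>+ \<omega>. indicator K \<omega> \<partial>M) < \<infinity>" using K by simp
    show "AE \<omega> in M. (\<lambda>n. indicator (B n) \<omega> :: ennreal) \<longlonglongrightarrow> 0"
      using along[unfolded frechet_subderivative_along_def] lim
    proof eventually_elim
      case (elim \<omega>)
      have "0 < \<delta> / R" using \<open>0 < \<delta>\<close> R(1) by simp
      from negative_part_difference_quotient_eventually_le[OF elim(1) r elim(2) this]
      have "\<forall>\<^sub>F n in sequentially. (indicator (B n) \<omega> :: ennreal) = 0"
      proof eventually_elim
        case (elim n)
        then have le: "negative_part (quotient (r n) (x n) \<omega>) \<le> ereal (\<delta> / R * norm (\<iota> (x n) \<omega>))"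
          by (simp add: difference_quotient_def)
        have "0 \<le> negative_part (quotient (r n) (x n) \<omega>)" by (simp add: negative_part_def)
        with le have "\<bar>u n \<omega>\<bar> \<le> \<delta> / R * norm (\<iota> (x n) \<omega>)"
          unfolding u_def by (cases "negative_part (quotient (r n) (x n) \<omega>)") auto
        moreover have "\<delta> / R * norm (\<iota> (x n) \<omega>) \<le> \<delta>" if "norm (\<iota> (x n) \<omega>) \<le> R"
          using that \<open>0 < \<delta>\<close> R(1) by (simp add: field_simps)
        ultimately show ?case by (auto simp: B_def indicator_def)
      qed
      then show ?case by (rule tendsto_eventually)
    qed
  qed measurable
  then have "\<forall>\<^sub>F n in sequentially. emeasure M (B n) < ennreal (\<eta> / 2)"
    using \<open>0 < \<eta>\<close> by (intro order_tendstoD(2)) auto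
  then show ?thesis
    unfolding u_def[symmetric]
  proof eventually_elim
    case (elim n)
    have [measurable]: "{\<omega>\<in>K. R < norm (\<iota> (x n) \<omega>)} \<in> sets M"
      by (intro sets_superlevel_in_subset K) measurable
    have "emeasure M {\<omega>\<in>K. \<delta> < \<bar>u n \<omega>\<bar>} \<le> emeasure M ({\<omega>\<in>K. R < norm (\<iota> (x n) \<omega>)} \<union> B n)"
      using sets.sets_into_space[OF K(1)] by (intro emeasure_mono) (auto simp: B_def)
    also have "\<dots> \<le> emeasure M {\<omega>\<in>K. R < norm (\<iota> (x n) \<omega>)} + emeasure M (B n)"
      by (intro emeasure_subadditive) measurable
    also have "\<dots> \<le> ennreal (\<eta> / 2) + ennreal (\<eta> / 2)"
      using R(2)[OF x] less_imp_le[OF elim] by (intro add_mono)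
    also have "\<dots> = ennreal \<eta>"
      using \<open>0 < \<eta>\<close> by (simp add: ennreal_plus[symmetric] del: ennreal_plus)
    finally show ?case .
  qed
qed

text \<open>Norm convergence gives only local convergence in measure, but if it is fast enough, the Borel-Cantelli lemma on an
  exhaustion \<open>K n\<close> by sets of finite measure gives convergence almost everywhere. Fixing
  the speed \<open>\<rho>\<close> in advance makes it unnecessary to pass to subsequences.\<close>

lemma fast_null_sequence_AE:
  obtains \<rho> :: "nat \<Rightarrow> real" where "\<And>n. 0 < \<rho> n"
    "\<And>y. (\<And>n. norm (y n) < \<rho> n) \<Longrightarrow> AE \<omega> in M. (\<lambda>n. \<iota> (y n) \<omega>) \<longlonglongrightarrow> 0"
proof -
  interpret sigma_finite_measure M by (rule sigma_finite)
  obtain K :: "nat \<Rightarrow> 'w set" where K: "range K \<subseteq> sets M" "(\<Union>k. K k) = space M"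
      "\<And>k. emeasure M (K k) \<noteq> \<infinity>" "incseq K"
    using sigma_finite_incseq by blast
  then have Km: "K n \<in> sets M" and Kfin: "emeasure M (K n) < \<infinity>" for n by (auto simp: less_top)
  have "\<exists>\<rho>>0. \<forall>y. norm y < \<rho> \<longrightarrow> emeasure M {\<omega>\<in>K n. (1/2)^n < norm (\<iota> y \<omega>)} \<le> ennreal ((1/2)^n)" for n
    by (intro small_in_measure Km Kfin) auto
  then obtain \<rho> where \<rho>: "\<And>n. 0 < \<rho> n" "\<And>n y. norm y < \<rho> n \<Longrightarrow>
      emeasure M {\<omega>\<in>K n. (1/2)^n < norm (\<iota> y \<omega>)} \<le> ennreal ((1/2)^n)"
    by metis
  show thesis
  proof (rule that[of \<rho>, OF \<rho>(1)])
    fix y :: "nat \<Rightarrow> 'x" assume y: "\<And>n. norm (y n) < \<rho> n"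
    define A where "A n = {\<omega>\<in>K n. (1/2)^n < norm (\<iota> (y n) \<omega>)}" for n
    have A_le: "emeasure M (A n) \<le> ennreal ((1/2)^n)" for n
      unfolding A_def by (rule \<rho>(2)[OF y])
    have "AE \<omega> in M. eventually (\<lambda>n. \<omega> \<in> space M - A n) sequentially"
    proof (rule borel_cantelli_AE1)
      show "A n \<in> sets M" for n
        unfolding A_def by (intro sets_superlevel_in_subset Km) measurable
      show "emeasure M (A n) < \<infinity>" for n
        using le_less_trans[OF A_le ennreal_less_top] by simp
      have "measure M (A n) \<le> (1/2)^n" for n
        unfolding measure_def using enn2real_mono[OF A_le[of n]] by simp
      then show "summable (\<lambda>n. measure M (A n))"
        by (intro summable_comparison_test'[OF summable_geometric[of "1/2 :: real"], of 0]) auto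
    qed
    then show "AE \<omega> in M. (\<lambda>n. \<iota> (y n) \<omega>) \<longlonglongrightarrow> 0"
      using AE_space
    proof eventually_elim
      case (elim \<omega>)
      from elim(2) obtain k where "\<omega> \<in> K k" using K(2) by auto
      then have "\<forall>\<^sub>F n in sequentially. \<omega> \<in> K n"
        using K(4) by (auto simp: eventually_sequentially incseq_def)
      with elim(1) have "\<forall>\<^sub>F n in sequentially. norm (\<iota> (y n) \<omega>) \<le> (1/2)^n"
        by eventually_elim (auto simp: A_def)
      then show ?case
        by (rule Lim_null_comparison) (auto intro: LIMSEQ_realpow_zero)
    qed
  qed
qed

lemma frechet_subderivative_if_lower_compactness:
  assumes along: "frechet_subderivative_along M f (\<iota> x0) xs"
    and compact: "frechet_lower_compactness M \<iota> g x0"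
  shows "frechet_subderivative (\<lambda>x. integral_functional M f (\<iota> x)) x0 (integral_pairing M \<iota> xs)"
proof (rule ccontr)
  assume "\<not> ?thesis"
  then obtain \<epsilon> where \<epsilon>: "0 < \<epsilon>"
      "\<And>\<delta>. 0 < \<delta> \<Longrightarrow> \<exists>z. norm z < \<delta> \<and> increment z < ereal (- \<epsilon> * norm z)"
    unfolding frechet_subderivative_iff_increment by (auto simp: not_le)
  obtain \<rho> where \<rho>: "\<And>n. 0 < \<rho> n"
      "\<And>y. (\<And>n. norm (y n) < \<rho> n) \<Longrightarrow> AE \<omega> in M. (\<lambda>n. \<iota> (y n) \<omega>) \<longlonglongrightarrow> 0"
    using fast_null_sequence_AE by blast
  \<comment> \<open>The bound \<open>\<rho> n\<close> forces convergence almost everywhere, the bound \<open>(1/2)^n\<close> forces \<open>r n\<close> to tend to \<open>0\<close>.\<close>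
  have "\<exists>z. norm z < min (\<rho> n) ((1/2)^n) \<and> increment z < ereal (- \<epsilon> * norm z)" for n
    using \<rho>(1)[of n] by (intro \<epsilon>(2)) auto
  then obtain y where y: "\<And>n. norm (y n) < min (\<rho> n) ((1/2)^n)"
      "\<And>n. increment (y n) < ereal (- \<epsilon> * norm (y n))"
    by metis
  have y_nonzero: "y n \<noteq> 0" for n
    using y(2)[of n] increment_zero by (auto simp: zero_ereal_def)
  define r where "r n = norm (y n)" for n
  define x where "x n = inverse (r n) *\<^sub>R y n" for n
  have r: "0 < r n" for n using y_nonzero by (simp add: r_def)
  have x: "norm (x n) \<le> 1" for n using r[of n] by (simp add: x_def r_def)
  have yx: "y n = r n *\<^sub>R x n" for n using r[of n] by (simp add: x_def)
  have "r \<longlonglongrightarrow> 0"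
  proof (rule Lim_null_comparison)
    show "\<forall>\<^sub>F n in sequentially. norm (r n) \<le> (1/2)^n"
      using y(1) by (auto simp: r_def intro!: always_eventually less_imp_le)
  qed (auto intro: LIMSEQ_realpow_zero)
  moreover have "bounded (range x)" using x by (auto simp: bounded_iff)
  ultimately have "\<exists>n0. (\<forall>n\<ge>n0. AE \<omega> in M. negative_part (quotient (r n) (x n) \<omega>) \<noteq> \<infinity>) \<and>
      uniformly_integrable M ((\<lambda>n \<omega>. real_of_ereal (negative_part (quotient (r n) (x n) \<omega>))) ` {n0..})"
    using compact[unfolded frechet_lower_compactness_def, THEN spec[of _ r], THEN spec[of _ x]] r by simp
  then obtain n0 where fin: "\<And>n. n \<ge> n0 \<Longrightarrow> AE \<omega> in M. negative_part (quotient (r n) (x n) \<omega>) \<noteq> \<infinity>"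
    and ui: "uniformly_integrable M
        ((\<lambda>n \<omega>. real_of_ereal (negative_part (quotient (r n) (x n) \<omega>))) ` {n0..})"
    by blast
  define u where "u n \<omega> = real_of_ereal (negative_part (quotient (r n) (x n) \<omega>))" for n \<omega>
  have ui: "uniformly_integrable M (u ` {n0..})" using ui unfolding u_def .
  have "AE \<omega> in M. \<forall>n. \<iota> (r n *\<^sub>R x n) \<omega> = r n *\<^sub>R \<iota> (x n) \<omega>"
    unfolding AE_all_countable by (intro allI representative_scaleR)
  moreover have "AE \<omega> in M. (\<lambda>n. \<iota> (y n) \<omega>) \<longlonglongrightarrow> 0" using y(1) by (intro \<rho>(2)) simp
  ultimately have "AE \<omega> in M. (\<lambda>n. r n *\<^sub>R \<iota> (x n) \<omega>) \<longlonglongrightarrow> 0"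
    by eventually_elim (simp add: yx)
  from negative_parts_locally_null_in_measure[OF along r x this]
  have "\<forall>\<^sub>F n in sequentially. emeasure M {\<omega>\<in>K. \<delta> < \<bar>u n \<omega>\<bar>} \<le> ennreal \<eta>"
    if "K \<in> sets M" "emeasure M K < \<infinity>" "0 < \<delta>" "0 < \<eta>" for K \<delta> \<eta>
    unfolding u_def using that by blast
  from Vitali_L1_null[OF ui this, of "\<epsilon> / 2"] \<epsilon>(1)
  have "\<forall>\<^sub>F n in sequentially. (\<integral>\<^sup>+ \<omega>. ennreal \<bar>u n \<omega>\<bar> \<partial>M) \<le> ennreal (\<epsilon> / 2)" by simp
  from eventually_conj[OF this eventually_ge_at_top[of n0]]
  obtain n where n: "n \<ge> n0" "(\<integral>\<^sup>+ \<omega>. ennreal \<bar>u n \<omega>\<bar> \<partial>M) \<le> ennreal (\<epsilon> / 2)"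
    by (auto simp: eventually_sequentially)
  have int: "integrable M (u n)" using ui n(1) unfolding uniformly_integrable_def by auto
  have u_nonneg: "0 \<le> u n \<omega>" for \<omega>
    unfolding u_def negative_part_def by (intro real_of_ereal_pos) simp
  have "integral\<^sup>L M (u n) \<le> \<epsilon> / 2"
    using n(2) nn_integral_eq_integral[OF int] u_nonneg \<epsilon>(1) by (simp add: ennreal_le_iff)
  then have "- \<epsilon> * r n < - (r n * integral\<^sup>L M (u n))"
    using r[of n] \<epsilon>(1) mult_left_mono[of "integral\<^sup>L M (u n)" "\<epsilon> / 2" "r n"]
    by (simp add: algebra_simps)
  have "ereal (- (r n * integral\<^sup>L M (u n))) = upper_integral M (\<lambda>\<omega>. ereal (- (r n * u n \<omega>)))"
    using upper_integral_ereal[of M "\<lambda>\<omega>. - (r n * u n \<omega>)"] int by simp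
  also have "\<dots> \<le> upper_integral M (\<lambda>\<omega>. ereal (r n) * quotient (r n) (x n) \<omega>)"
  proof (rule upper_integral_mono_AE)
    show "AE \<omega> in M. ereal (- (r n * u n \<omega>)) \<le> ereal (r n) * quotient (r n) (x n) \<omega>"
      using fin[OF n(1)]
    proof eventually_elim
      case (elim \<omega>)
      then show ?case
        using r[of n] unfolding u_def negative_part_def
        by (cases "quotient (r n) (x n) \<omega>") (auto simp: max_def)
    qed
  qed
  also have "\<dots> = increment (y n)"
    unfolding yx by (rule increment_scaleR[OF r, symmetric])
  also have "\<dots> < ereal (- \<epsilon> * r n)" using y(2)[of n] by (simp add: r_def)
  finally show False using \<open>- \<epsilon> * r n < - (r n * integral\<^sup>L M (u n))\<close> by simp
qed

end

section \<open>The equivalence\<close>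

theorem theorem10p2:
  fixes M :: "'w measure"
    and \<iota> :: "'x::real_normed_vector \<Rightarrow> 'w \<Rightarrow> 'e::{banach, second_countable_topology}"
    and p :: ennreal
    and \<beta> :: "'w \<Rightarrow> real"
    and f :: "'w \<Rightarrow> 'e \<Rightarrow> ereal"
    and x0 :: 'x
    and xs :: "'w \<Rightarrow> 'e \<Rightarrow>\<^sub>L real"
  assumes "sigma_finite_measure M"
    and "complete_measure M"
    and "normed_L0_subspace M \<iota>"
    and "decomposable M \<iota>"
    and "1 \<le> p"
    and "\<beta> \<in> borel_measurable M"
    and "\<forall>\<omega>\<in>space M. 0 < \<beta> \<omega>"
    and "continuously_included_in_Lp \<iota> p (density M (\<lambda>\<omega>. ennreal (\<beta> \<omega>)))"
    and "solid_frechet_bornology M \<iota>"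
    and "measurable_integrand M f"
    and "\<bar>integral_functional M f (\<iota> x0)\<bar> \<noteq> \<infinity>"
    and "in_dual_L0 M \<iota> xs"
  shows "(frechet_subderivative (\<lambda>x. integral_functional M f (\<iota> x)) x0 (integral_pairing M \<iota> xs)
            \<longrightarrow> frechet_lower_compactness M \<iota> (\<lambda>\<omega> e. f \<omega> e - ereal (blinfun_apply (xs \<omega>) e)) x0)
       \<and> (frechet_subderivative_along M f (\<iota> x0) xs
            \<longrightarrow> frechet_lower_compactness M \<iota> (\<lambda>\<omega> e. f \<omega> e - ereal (blinfun_apply (xs \<omega>) e)) x0
            \<longrightarrow> frechet_subderivative (\<lambda>x. integral_functional M f (\<iota> x)) x0 (integral_pairing M \<iota> xs))"
proof -
  interpret integral_functional_on_decomposable_space M \<iota> p \<beta> f x0 xs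
    by (rule integral_functional_on_decomposable_space.intro; fact assms)
  show ?thesis
    using lower_compactness_if_frechet_subderivative frechet_subderivative_if_lower_compactness by blast
qed

end
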